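(* Let $M$ be a smooth manifold, $\tilde g$ a nondegenerate semi-Riemannian metric on $M$, and $\Omega\in C^\infty(M)$ with $\Omega\ge0$. Then $(M,g)$ with $g=\Omega^2\tilde g$ is a semi-regular semi-Riemannian manifold.
   Context: $(M,g)$ is a singular semi-Riemannian manifold: $g$ a smooth symmetric, possibly degenerate, bilinear form on $TM$. $u^\flat(v)=g(u,v)$; $T^\bullet_pM=\{u^\flat:u\in T_pM\}$ with the well-defined nondegenerate inner product $\langle\langle u^\flat,v^\flat\rangle\rangle=g(u,v)$; $\mathcal A^\bullet(M)$ = smooth $1$-forms $\omega$ with $\omega_p\in T^\bullet_pM$ for all $p$. Koszul form $\mathcal K(X,Y,Z)=\tfrac12\{Xg(Y,Z)+Yg(Z,X)-Zg(X,Y)-g(X,[Y,Z])+g(Y,[Z,X])+g(Z,[X,Y])\}$; $\nabla^\flat_XY:=\mathcal K(X,Y,\cdot)$. $(M,g)$ is radical-stationary if $\nabla^\flat_XY\in\mathcal A^\bullet(M)$ for all $X,Y\in\mathfrak X(M)$; then for $\omega\in\mathcal A^\bullet(M)$ define $(\nabla_X\omega)(Y)=X(\omega(Y))-\langle\langle\nabla^\flat_XY,\omega\rangle\rangle$ (pointwise). $(M,g)$ is semi-regular if it is radical-stationary and $\nabla_Z(\nabla^\flat_XY)\in\mathcal A^\bullet(M)$ (in particular a smooth $1$-form) for all $X,Y,Z\in\mathfrak X(M)$. *)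

theory Defs
  imports "HOL-Analysis.Analysis"
begin

text \<open>A real-valued function on an open set S of real^'n is C-infinity iff all its
  iterated partial derivatives exist on S and are continuous on S.  D is gives the
  iterated partial derivative; D (i # is) is the partial derivative in direction i of D is.\<close>

definition smooth_on :: "(real^'n) set \<Rightarrow> (real^'n \<Rightarrow> real) \<Rightarrow> bool" where
  "smooth_on S f \<longleftrightarrow>
     (\<exists>D :: 'n list \<Rightarrow> real^'n \<Rightarrow> real.
        (\<forall>x\<in>S. D [] x = f x) \<and>
        (\<forall>is. continuous_on S (D is)) \<and>
        (\<forall>is i. \<forall>x\<in>S.
           ((\<lambda>t. D is (x + t *\<^sub>R axis i 1)) has_real_derivative D (i # is) x) (at 0)))"

text \<open>The manifold is the whole (Hausdorff, second countable) space of type 'a; an atlas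
  is a set of charts (U, phi) with phi a homeomorphism of the open set U onto an open
  subset of real^'n, covering the space, with smooth transition maps.\<close>

definition chart :: "'a::topological_space set \<Rightarrow> ('a \<Rightarrow> real^'n) \<Rightarrow> bool" where
  "chart U \<phi> \<longleftrightarrow> open U \<and> open (\<phi> ` U) \<and> inj_on \<phi> U \<and>
     continuous_on U \<phi> \<and> continuous_on (\<phi> ` U) (inv_into U \<phi>)"

definition smooth_atlas :: "('a::{t2_space,second_countable_topology} set \<times> ('a \<Rightarrow> real^'n)) set \<Rightarrow> bool" where
  "smooth_atlas A \<longleftrightarrow>
     (\<forall>(U,\<phi>)\<in>A. chart U \<phi>) \<and>
     (\<Union>(fst ` A) = UNIV) \<and>
     (\<forall>(U,\<phi>)\<in>A. \<forall>(V,\<psi>)\<in>A. \<forall>i.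
        smooth_on (\<phi> ` (U \<inter> V)) (\<lambda>x. (\<psi> (inv_into U \<phi> x)) $ i))"

definition smooth_fun :: "('a set \<times> ('a \<Rightarrow> real^'n)) set \<Rightarrow> ('a \<Rightarrow> real) \<Rightarrow> bool" where
  "smooth_fun A f \<longleftrightarrow> (\<forall>(U,\<phi>)\<in>A. smooth_on (\<phi> ` U) (f \<circ> inv_into U \<phi>))"

text \<open>Tangent vectors at p: point derivations of C-infinity(M) at p, normalised to vanish
  on non-smooth functions (so that equality of tangent vectors is plain equality).\<close>
definition tangent_space :: "('a set \<times> ('a \<Rightarrow> real^'n)) set \<Rightarrow> 'a \<Rightarrow> (('a \<Rightarrow> real) \<Rightarrow> real) set" where
  "tangent_space A p = {v.
     (\<forall>f. \<not> smooth_fun A f \<longrightarrow> v f = 0) \<and>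
     (\<forall>f h. smooth_fun A f \<longrightarrow> smooth_fun A h \<longrightarrow> v (\<lambda>q. f q + h q) = v f + v h) \<and>
     (\<forall>c f. smooth_fun A f \<longrightarrow> v (\<lambda>q. c * f q) = c * v f) \<and>
     (\<forall>f h. smooth_fun A f \<longrightarrow> smooth_fun A h \<longrightarrow> v (\<lambda>q. f q * h q) = f p * v h + h p * v f)}"

definition vector_fields :: "('a set \<times> ('a \<Rightarrow> real^'n)) set \<Rightarrow> (('a \<Rightarrow> real) \<Rightarrow> ('a \<Rightarrow> real)) set" where
  "vector_fields A = {X.
     (\<forall>f. \<not> smooth_fun A f \<longrightarrow> X f = (\<lambda>q. 0)) \<and>
     (\<forall>f. smooth_fun A f \<longrightarrow> smooth_fun A (X f)) \<and>
     (\<forall>f h. smooth_fun A f \<longrightarrow> smooth_fun A h \<longrightarrow> X (\<lambda>q. f q + h q) = (\<lambda>q. X f q + X h q)) \<and>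
     (\<forall>c f. smooth_fun A f \<longrightarrow> X (\<lambda>q. c * f q) = (\<lambda>q. c * X f q)) \<and>
     (\<forall>f h. smooth_fun A f \<longrightarrow> smooth_fun A h \<longrightarrow>
        X (\<lambda>q. f q * h q) = (\<lambda>q. f q * X h q + h q * X f q))}"

definition at_pt :: "(('a \<Rightarrow> real) \<Rightarrow> ('a \<Rightarrow> real)) \<Rightarrow> 'a \<Rightarrow> (('a \<Rightarrow> real) \<Rightarrow> real)" where
  "at_pt X p = (\<lambda>f. X f p)"

definition lie_bracket :: "(('a \<Rightarrow> real) \<Rightarrow> ('a \<Rightarrow> real)) \<Rightarrow> (('a \<Rightarrow> real) \<Rightarrow> ('a \<Rightarrow> real)) \<Rightarrow> (('a \<Rightarrow> real) \<Rightarrow> ('a \<Rightarrow> real))" where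
  "lie_bracket X Y = (\<lambda>f q. X (Y f) q - Y (X f) q)"

type_synonym 'a bilin = "'a \<Rightarrow> (('a \<Rightarrow> real) \<Rightarrow> real) \<Rightarrow> (('a \<Rightarrow> real) \<Rightarrow> real) \<Rightarrow> real"

definition gfun :: "'a bilin \<Rightarrow> (('a \<Rightarrow> real) \<Rightarrow> ('a \<Rightarrow> real)) \<Rightarrow> (('a \<Rightarrow> real) \<Rightarrow> ('a \<Rightarrow> real)) \<Rightarrow> ('a \<Rightarrow> real)" where
  "gfun g X Y = (\<lambda>p. g p (at_pt X p) (at_pt Y p))"

definition sym_bilinear_metric :: "('a set \<times> ('a \<Rightarrow> real^'n)) set \<Rightarrow> 'a bilin \<Rightarrow> bool" where
  "sym_bilinear_metric A g \<longleftrightarrow>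
     (\<forall>p. \<forall>v\<in>tangent_space A p. \<forall>w\<in>tangent_space A p. g p v w = g p w v) \<and>
     (\<forall>p. \<forall>u\<in>tangent_space A p. \<forall>v\<in>tangent_space A p. \<forall>w\<in>tangent_space A p.
        g p (\<lambda>f. u f + v f) w = g p u w + g p v w) \<and>
     (\<forall>p c. \<forall>v\<in>tangent_space A p. \<forall>w\<in>tangent_space A p.
        g p (\<lambda>f. c * v f) w = c * g p v w) \<and>
     (\<forall>X\<in>vector_fields A. \<forall>Y\<in>vector_fields A. smooth_fun A (gfun g X Y))"

definition nondegenerate :: "('a set \<times> ('a \<Rightarrow> real^'n)) set \<Rightarrow> 'a bilin \<Rightarrow> bool" where
  "nondegenerate A g \<longleftrightarrow>
     (\<forall>p. \<forall>v\<in>tangent_space A p. (\<forall>w\<in>tangent_space A p. g p v w = 0) \<longrightarrow> v = (\<lambda>f. 0))"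

definition semi_riemannian_metric :: "('a set \<times> ('a \<Rightarrow> real^'n)) set \<Rightarrow> 'a bilin \<Rightarrow> bool" where
  "semi_riemannian_metric A g \<longleftrightarrow> sym_bilinear_metric A g \<and> nondegenerate A g"

definition koszul :: "'a bilin \<Rightarrow> (('a \<Rightarrow> real) \<Rightarrow> ('a \<Rightarrow> real)) \<Rightarrow> (('a \<Rightarrow> real) \<Rightarrow> ('a \<Rightarrow> real))
     \<Rightarrow> (('a \<Rightarrow> real) \<Rightarrow> ('a \<Rightarrow> real)) \<Rightarrow> ('a \<Rightarrow> real)" where
  "koszul g X Y Z = (\<lambda>p. (1/2) *
      (X (gfun g Y Z) p + Y (gfun g Z X) p - Z (gfun g X Y) p
       - gfun g X (lie_bracket Y Z) p + gfun g Y (lie_bracket Z X) p + gfun g Z (lie_bracket X Y) p))"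

text \<open>1-forms are represented by their action on vector fields: omega Z is the function p \<mapsto> omega_p(Z_p).\<close>
type_synonym 'a oneform = "(('a \<Rightarrow> real) \<Rightarrow> ('a \<Rightarrow> real)) \<Rightarrow> ('a \<Rightarrow> real)"

definition nabla_flat :: "'a bilin \<Rightarrow> (('a \<Rightarrow> real) \<Rightarrow> ('a \<Rightarrow> real)) \<Rightarrow> (('a \<Rightarrow> real) \<Rightarrow> ('a \<Rightarrow> real)) \<Rightarrow> 'a oneform" where
  "nabla_flat g X Y = (\<lambda>Z. koszul g X Y Z)"

definition smooth_one_form :: "('a set \<times> ('a \<Rightarrow> real^'n)) set \<Rightarrow> 'a oneform \<Rightarrow> bool" where
  "smooth_one_form A \<omega> \<longleftrightarrow>
     (\<forall>Z\<in>vector_fields A. smooth_fun A (\<omega> Z)) \<and>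
     (\<forall>Z\<in>vector_fields A. \<forall>W\<in>vector_fields A. \<forall>f. smooth_fun A f \<longrightarrow>
        \<omega> (\<lambda>h q. f q * Z h q + W h q) = (\<lambda>q. f q * \<omega> Z q + \<omega> W q))"

definition flat_rep :: "('a set \<times> ('a \<Rightarrow> real^'n)) set \<Rightarrow> 'a bilin \<Rightarrow> 'a oneform \<Rightarrow> 'a \<Rightarrow> (('a \<Rightarrow> real) \<Rightarrow> real) \<Rightarrow> bool" where
  "flat_rep A g \<omega> p u \<longleftrightarrow> u \<in> tangent_space A p \<and> (\<forall>Z\<in>vector_fields A. \<omega> Z p = g p u (at_pt Z p))"

definition A_bullet :: "('a set \<times> ('a \<Rightarrow> real^'n)) set \<Rightarrow> 'a bilin \<Rightarrow> 'a oneform \<Rightarrow> bool" where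
  "A_bullet A g \<omega> \<longleftrightarrow> smooth_one_form A \<omega> \<and> (\<forall>p. \<exists>u. flat_rep A g \<omega> p u)"

text \<open>The inner product on T-bullet_p M: <<u^flat, v^flat>> = g(u,v).\<close>
definition inner_bullet :: "('a set \<times> ('a \<Rightarrow> real^'n)) set \<Rightarrow> 'a bilin \<Rightarrow> 'a \<Rightarrow> 'a oneform \<Rightarrow> 'a oneform \<Rightarrow> real" where
  "inner_bullet A g p \<alpha> \<beta> = g p (SOME u. flat_rep A g \<alpha> p u) (SOME v. flat_rep A g \<beta> p v)"

definition radical_stationary :: "('a set \<times> ('a \<Rightarrow> real^'n)) set \<Rightarrow> 'a bilin \<Rightarrow> bool" where
  "radical_stationary A g \<longleftrightarrow>
     (\<forall>X\<in>vector_fields A. \<forall>Y\<in>vector_fields A. A_bullet A g (nabla_flat g X Y))"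

definition nabla_cov :: "('a set \<times> ('a \<Rightarrow> real^'n)) set \<Rightarrow> 'a bilin \<Rightarrow> (('a \<Rightarrow> real) \<Rightarrow> ('a \<Rightarrow> real)) \<Rightarrow> 'a oneform \<Rightarrow> 'a oneform" where
  "nabla_cov A g X \<omega> = (\<lambda>Y p. X (\<omega> Y) p - inner_bullet A g p (nabla_flat g X Y) \<omega>)"

definition semi_regular :: "('a set \<times> ('a \<Rightarrow> real^'n)) set \<Rightarrow> 'a bilin \<Rightarrow> bool" where
  "semi_regular A g \<longleftrightarrow> radical_stationary A g \<and>
     (\<forall>X\<in>vector_fields A. \<forall>Y\<in>vector_fields A. \<forall>Z\<in>vector_fields A.
        A_bullet A g (nabla_cov A g Z (nabla_flat g X Y)))"

end

theory Submission
  imports Defs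
begin

text \<open>Let K be the Koszul form of the metric \<Omega>^2 g.  By the product rule,
  K(X,Y,Z) = \<Omega> \<kappa>(X,Y,Z) with
  \<kappa>(X,Y,Z) = \<Omega> K'(X,Y,Z) + X\<Omega> g(Y,Z) + Y\<Omega> g(Z,X) - Z\<Omega> g(X,Y), where K' is the Koszul form of g.
  As \<kappa>(X,Y,-) is a smooth one-form and g is nondegenerate, \<kappa>(X,Y,-) = g(R(X,Y),-) for a vector field R(X,Y).
  Since \<Omega> \<ge> 0, its differential vanishes at its zeros, hence so do \<kappa> and R.  Thus R(X,Y)/\<Omega>, read
  as 0 at the zeros, represents K(X,Y,-), and the inner product of K(Z,W,-) and K(X,Y,-) is
  g(R(Z,W),R(X,Y)) everywhere, which is smooth.  The covariant derivative is therefore a smooth one-form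
  that vanishes at the zeros of \<Omega>, so it is representable at every point.
  The dual vector field is obtained by Cramer's rule in local frames; that these frames span
  all point derivations is Hadamard's lemma.\<close>

subsection \<open>Smooth functions on open subsets of Euclidean space\<close>

text \<open>Tangent vectors are derivations of functions that are smooth on the whole manifold,
  whereas coordinates and the functions of Hadamard's lemma live on a chart ball only. Each of them
  is therefore multiplied by a bump function b; the frame identities carry the power
  \<open>b ^ 3\<close> that accumulates, and division takes place only where b is nonzero. The local
  dual vectors glue because nondegeneracy makes the dual vector at each point unique: it can be
  chosen pointwise, and only its smoothness is a local matter. That a single factor \<Omega> in the
  Koszul form suffices is due to the inner product: the two representatives have the denominator
  \<Omega> each, and the metric \<Omega>^2 g cancels both exactly. The covariant derivative is
  linear over smooth functions although neither of its two terms is: the surplus of the product rule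
  in the first is the surplus of the Koszul form, as a derivation in its second argument, in the
  other.\<close>

definition has_partial :: "(real^'n \<Rightarrow> real) \<Rightarrow> 'n \<Rightarrow> real \<Rightarrow> real^'n \<Rightarrow> bool" where
  "has_partial f i d x \<longleftrightarrow> ((\<lambda>t. f (x + t *\<^sub>R axis i 1)) has_real_derivative d) (at 0)"

text \<open>Smoothness as a greatest fixed point: choosing, for every member of P, a partial
  derivative that is again in P and folding these choices along the index list yields the family D.
  Closure proofs then only exhibit an invariant and avoid formulas for higher derivatives.\<close>

lemma smooth_on_coinduct:
  fixes f :: "real^'n \<Rightarrow> real"
  assumes "P f"
    and cont: "\<And>f. P f \<Longrightarrow> continuous_on S f"
    and step: "\<And>f i. P f \<Longrightarrow> \<exists>f'. P f' \<and> (\<forall>x\<in>S. has_partial f i (f' x) x)"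
  shows "smooth_on S f"
proof -
  obtain \<delta> where \<delta>: "\<And>f i. P f \<Longrightarrow> P (\<delta> i f)"
    "\<And>f i x. P f \<Longrightarrow> x \<in> S \<Longrightarrow> has_partial f i (\<delta> i f x) x"
  proof -
    have "\<forall>i f. \<exists>f'. P f \<longrightarrow> P f' \<and> (\<forall>x\<in>S. has_partial f i (f' x) x)"
      using step by blast
    then show ?thesis using that by metis
  qed
  define D where "D is = foldr \<delta> is f" for "is"
  have P: "P (D is)" for "is"
    by (induction "is") (auto simp: D_def \<open>P f\<close> \<delta>)
  show ?thesis
    unfolding smooth_on_def
  proof (intro exI[of _ D] conjI allI ballI)
    fix "is" i x assume "x \<in> S"
    then show "((\<lambda>t. D is (x + t *\<^sub>R axis i 1)) has_real_derivative D (i # is) x) (at 0)"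
      using \<delta>(2)[OF P] by (simp add: D_def has_partial_def)
  qed (simp_all add: cont P, simp add: D_def)
qed

lemma eventually_shift_in_open:
  fixes x :: "real^'n"
  assumes "open S" "x \<in> S"
  shows "\<forall>\<^sub>F t in nhds (0::real). x + t *\<^sub>R axis i 1 \<in> S"
proof -
  have "open ((\<lambda>t::real. x + t *\<^sub>R axis i 1) -` S)"
    by (intro open_vimage continuous_intros assms)
  moreover have "0 \<in> (\<lambda>t::real. x + t *\<^sub>R axis i 1) -` S"
    using assms by simp
  ultimately show ?thesis
    unfolding eventually_nhds by blast
qed

lemma has_partial_cong:
  assumes "open S" "x \<in> S" "\<And>y. y \<in> S \<Longrightarrow> f y = g y"
  shows "has_partial f i d x \<longleftrightarrow> has_partial g i d x"
  unfolding has_partial_def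
proof (rule DERIV_cong_ev)
  show "\<forall>\<^sub>F t in nhds 0. f (x + t *\<^sub>R axis i 1) = g (x + t *\<^sub>R axis i 1)"
    using eventually_shift_in_open[OF assms(1,2), of i] by (rule eventually_mono) (rule assms(3))
qed simp_all

lemma has_partial_unique: "has_partial f i d x \<Longrightarrow> has_partial f i e x \<Longrightarrow> d = e"
  unfolding has_partial_def by (rule DERIV_unique)

lemma smooth_on_cong:
  assumes "smooth_on S f" and eq: "\<And>x. x \<in> S \<Longrightarrow> f x = g x"
  shows "smooth_on S g"
  using assms(1) unfolding smooth_on_def
  by (elim exE conjE, intro exI conjI) (auto simp: eq)

lemma smooth_on_subset:
  assumes "smooth_on S f" "T \<subseteq> S"
  shows "smooth_on T f"
  using assms(1) unfolding smooth_on_def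
proof (elim exE, goal_cases)
  case (1 D)
  then show ?case
    using assms(2) by (intro exI[of _ D]) (auto intro: continuous_on_subset)
qed

lemma smooth_on_imp_continuous_on:
  assumes "smooth_on S f"
  shows "continuous_on S f"
  using assms unfolding smooth_on_def
proof (elim exE conjE)
  fix D :: "'a list \<Rightarrow> real^'a \<Rightarrow> real"
  assume D: "\<forall>x\<in>S. D [] x = f x" "\<forall>is. continuous_on S (D is)"
  from D(2) have "continuous_on S (D [])" ..
  then show ?thesis by (rule continuous_on_eq) (use D(1) in blast)
qed

lemma smooth_on_partial:
  assumes "smooth_on S f" "open S"
  shows "\<exists>f'. smooth_on S f' \<and> (\<forall>x\<in>S. has_partial f i (f' x) x)"
proof -
  from assms(1) obtain D where D: "\<And>x. x \<in> S \<Longrightarrow> D [] x = f x" "\<And>is. continuous_on S (D is)"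
    "\<And>is i x. x \<in> S \<Longrightarrow> has_partial (D is) i (D (i # is) x) x"
    unfolding smooth_on_def has_partial_def by metis
  have "smooth_on S (D [i])"
    unfolding smooth_on_def
    \<comment> \<open>The head of the list is the derivative taken last, so the first one, in
      direction i, belongs at the end.\<close>
    by (rule exI[of _ "\<lambda>is. D (is @ [i])"]) (use D in \<open>auto simp: has_partial_def\<close>)
  moreover have "has_partial f i (D [i] x) x" if "x \<in> S" for x
    using D(3)[OF that, of "[]"] has_partial_cong[OF assms(2) that D(1)] by simp
  ultimately show ?thesis by blast
qed

text \<open>The families D on different neighbourhoods need not agree, so they cannot simply be
  glued. Local smoothness itself is the coinduction invariant; uniqueness of partial derivatives
  makes one globally chosen \<open>f'\<close> agree with the local derivatives.\<close>

lemma smooth_on_local: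
  assumes "\<And>x. x \<in> S \<Longrightarrow> \<exists>T. open T \<and> x \<in> T \<and> smooth_on T f"
  shows "smooth_on S f"
proof (rule smooth_on_coinduct[where P = "\<lambda>f. \<forall>x\<in>S. \<exists>T. open T \<and> x \<in> T \<and> smooth_on T f"])
  fix f :: "real^'a \<Rightarrow> real" assume f: "\<forall>x\<in>S. \<exists>T. open T \<and> x \<in> T \<and> smooth_on T f"
  show "continuous_on S f"
    using f smooth_on_imp_continuous_on continuous_on_eq_continuous_at continuous_at_imp_continuous_on
    by metis
  fix i
  define f' where "f' x = (SOME d. has_partial f i d x)" for x
  have *: "has_partial f i (f' x) x" if "has_partial f i d x" for d x
    unfolding f'_def using that by (rule someI)
  show "\<exists>f'. (\<forall>x\<in>S. \<exists>T. open T \<and> x \<in> T \<and> smooth_on T f') \<and> (\<forall>x\<in>S. has_partial f i (f' x) x)"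
  proof (intro exI[of _ f'] conjI ballI)
    fix x assume "x \<in> S"
    with f obtain T where T: "open T" "x \<in> T" "smooth_on T f" by blast
    from smooth_on_partial[OF T(3,1)] obtain d
      where d: "smooth_on T d" "\<And>x. x \<in> T \<Longrightarrow> has_partial f i (d x) x" by blast
    have "smooth_on T f'"
      using d(1) by (rule smooth_on_cong) (use d(2) * has_partial_unique in metis)
    then show "\<exists>T. open T \<and> x \<in> T \<and> smooth_on T f'" using T by blast
    show "has_partial f i (f' x) x" using * d(2) T(2) by blast
  qed
qed (use assms in blast)

text \<open>Coordinates are switched on one at a time, by induction on the set J of those already
  moved. For the next coordinate the mean value theorem gives a partial derivative at a nearby
  point, and continuity replaces that point by x.\<close>

lemma has_derivative_of_partials:
  fixes f :: "real^'n \<Rightarrow> real"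
  assumes S: "open S" "x \<in> S"
    and part: "\<And>i y. y \<in> S \<Longrightarrow> has_partial f i (f' i y) y"
    and cont: "\<And>i. continuous_on S (f' i)"
  shows "(f has_derivative (\<lambda>h. \<Sum>i\<in>UNIV. h $ i * f' i x)) (at x)"
proof -
  define pr where "pr J h = (\<chi> i. if i \<in> J then h $ i else 0)" for J and h :: "real^'n"
  have pr_le: "norm (pr J h) \<le> norm h" for J h
    by (rule norm_le_componentwise_cart) (simp add: pr_def)
  have claim: "\<exists>\<delta>>0. \<forall>h. norm h < \<delta> \<longrightarrow>
      \<bar>f (x + pr J h) - f x - (\<Sum>i\<in>J. h $ i * f' i x)\<bar> \<le> e * norm h"
    if "finite J" "e > 0" for J e
    using that
  proof (induction J arbitrary: e)
    case empty
    have "pr {} h = 0" for h by (simp add: pr_def vec_eq_iff)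
    then show ?case using empty by (auto intro: exI[of _ 1])
  next
    case (insert j J)
    \<comment> \<open>Half of e pays for the coordinates in J, the other half for the new coordinate
      j.\<close>
    from insert.IH[of "e/2"] insert.prems obtain \<delta>1 where \<delta>1: "\<delta>1 > 0" "\<And>h. norm h < \<delta>1 \<Longrightarrow>
      \<bar>f (x + pr J h) - f x - (\<Sum>i\<in>J. h $ i * f' i x)\<bar> \<le> e/2 * norm h" by auto
    obtain \<delta>2 where \<delta>2: "\<delta>2 > 0" "ball x \<delta>2 \<subseteq> S"
      using S open_contains_ball by blast
    have "continuous (at x) (f' j)"
      using cont S continuous_on_eq_continuous_at by blast
    then obtain \<delta>3 where \<delta>3: "\<delta>3 > 0" "\<And>y. dist y x < \<delta>3 \<Longrightarrow> \<bar>f' j y - f' j x\<bar> < e/2"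
      using insert.prems unfolding continuous_at_eps_delta dist_real_def
      by (meson half_gt_zero)
    define \<delta> where "\<delta> = min \<delta>1 (min \<delta>2 \<delta>3)"
    show ?case
    proof (intro exI[of _ \<delta>] conjI allI impI)
      show "\<delta> > 0" using \<delta>1 \<delta>2 \<delta>3 by (simp add: \<delta>_def)
      fix h :: "real^'n" assume h: "norm h < \<delta>"
      define z where "z t = x + pr J h + t *\<^sub>R axis j 1" for t :: real
      have z_near: "norm (z t - x) \<le> norm h" if "\<bar>t\<bar> \<le> \<bar>h $ j\<bar>" for t
      proof -
        have "z t - x = pr J h + t *\<^sub>R axis j 1" by (simp add: z_def)
        also have "norm \<dots> \<le> norm h"
          by (rule norm_le_componentwise_cart)
            (use insert.hyps that in \<open>auto simp: pr_def axis_def\<close>)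
        finally show ?thesis .
      qed
      have der: "((\<lambda>t. f (z t)) has_real_derivative f' j (z t)) (at t)" if "\<bar>t\<bar> \<le> \<bar>h $ j\<bar>" for t
      proof -
        have "z t \<in> S"
          using z_near[OF that] h \<delta>2(2) by (auto simp: \<delta>_def dist_norm norm_minus_commute)
        from part[OF this, of j] have
          "((\<lambda>s. f (z (s + t))) has_real_derivative f' j (z t)) (at 0)"
          by (simp add: has_partial_def z_def algebra_simps)
        then show ?thesis using DERIV_shift[of "\<lambda>t. f (z t)" _ 0 t] by simp
      qed
      have "\<bar>f (z (h $ j)) - f (z 0) - h $ j * f' j x\<bar> \<le> e/2 * norm h"
      proof -
        have "\<exists>\<xi>. \<bar>\<xi>\<bar> \<le> \<bar>h $ j\<bar> \<and> f (z (h $ j)) - f (z 0) = h $ j * f' j (z \<xi>)"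
        proof (cases "h $ j" "0::real" rule: linorder_cases)
          case less
          then have "\<exists>\<xi>. h $ j < \<xi> \<and> \<xi> < 0 \<and> f (z 0) - f (z (h$j)) = (0 - h $ j) * f' j (z \<xi>)"
            by (intro MVT2) (auto intro!: der)
          then obtain \<xi> where "h $ j < \<xi>" "\<xi> < 0" "f (z 0) - f (z (h$j)) = - (h $ j * f' j (z \<xi>))"
            by auto
          then show ?thesis by (intro exI[of _ \<xi>]) auto
        next
          case greater
          then have "\<exists>\<xi>. 0 < \<xi> \<and> \<xi> < h $ j \<and> f (z (h$j)) - f (z 0) = (h $ j - 0) * f' j (z \<xi>)"
            by (intro MVT2) (auto intro!: der)
          then show ?thesis by force
        qed simp
        then obtain \<xi> where \<xi>: "\<bar>\<xi>\<bar> \<le> \<bar>h $ j\<bar>" "f (z (h $ j)) - f (z 0) = h $ j * f' j (z \<xi>)"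
          by blast
        have "\<bar>f' j (z \<xi>) - f' j x\<bar> \<le> e/2"
          using \<delta>3(2)[of "z \<xi>"] z_near[OF \<xi>(1)] h by (auto simp: \<delta>_def dist_norm)
        then have "\<bar>h $ j\<bar> * \<bar>f' j (z \<xi>) - f' j x\<bar> \<le> norm h * (e/2)"
          by (intro mult_mono component_le_norm_cart) auto
        moreover have "f (z (h $ j)) - f (z 0) - h $ j * f' j x = h $ j * (f' j (z \<xi>) - f' j x)"
          by (simp add: \<xi>(2) algebra_simps)
        ultimately show ?thesis by (simp add: abs_mult mult.commute)
      qed
      moreover have "\<bar>f (x + pr J h) - f x - (\<Sum>i\<in>J. h $ i * f' i x)\<bar> \<le> e/2 * norm h"
        using \<delta>1(2) h by (simp add: \<delta>_def)
      ultimately have le: "\<bar>f (z (h $ j)) - f (z 0) - h $ j * f' j x\<bar>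
          + \<bar>f (x + pr J h) - f x - (\<Sum>i\<in>J. h $ i * f' i x)\<bar> \<le> e * norm h" by linarith
      have "z (h $ j) = x + pr (insert j J) h"
        using insert.hyps by (auto simp: z_def pr_def axis_def vec_eq_iff)
      then have eq: "f (x + pr (insert j J) h) - f x - (\<Sum>i\<in>insert j J. h $ i * f' i x)
          = (f (z (h $ j)) - f (z 0) - h $ j * f' j x)
            + (f (x + pr J h) - f x - (\<Sum>i\<in>J. h $ i * f' i x))"
        using insert.hyps by (simp add: z_def add.assoc)
      show "\<bar>f (x + pr (insert j J) h) - f x - (\<Sum>i\<in>insert j J. h $ i * f' i x)\<bar> \<le> e * norm h"
        unfolding eq by (rule order_trans[OF abs_triangle_ineq le])
    qed
  qed
  have "pr UNIV h = h" for h by (simp add: pr_def)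
  with claim[of UNIV] have *: "\<exists>\<delta>>0. \<forall>h. norm h < \<delta> \<longrightarrow>
      \<bar>f (x + h) - f x - (\<Sum>i\<in>UNIV. h $ i * f' i x)\<bar> \<le> e * norm h" if "e > 0" for e
    using that by simp
  show ?thesis
    unfolding has_derivative_at_alt
  proof (intro conjI allI impI)
    show "bounded_linear (\<lambda>h. \<Sum>i\<in>UNIV. h $ i * f' i x)"
      by (intro bounded_linear_sum bounded_linear_mult_const bounded_linear_vec_nth)
    fix e :: real assume "e > 0"
    from *[OF this] obtain \<delta> where \<delta>: "\<delta> > 0" "\<And>h. norm h < \<delta> \<Longrightarrow>
      \<bar>f (x + h) - f x - (\<Sum>i\<in>UNIV. h $ i * f' i x)\<bar> \<le> e * norm h" by blast
    show "\<exists>d>0. \<forall>y. norm (y - x) < d \<longrightarrow>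
        norm (f y - f x - (\<Sum>i\<in>UNIV. (y - x) $ i * f' i x)) \<le> e * norm (y - x)"
      using \<delta>(1) \<delta>(2)[of "_ - x"] by (intro exI[of _ \<delta>]) auto
  qed
qed

text \<open>The form of the chain rule behind composition of smooth maps, differentiation under the
  integral sign and integration along a segment.\<close>

lemma has_real_derivative_along_curve:
  fixes f :: "real^'n \<Rightarrow> real" and \<gamma> :: "real \<Rightarrow> real^'n"
  assumes "open S" "\<gamma> t \<in> S"
    and "\<And>i y. y \<in> S \<Longrightarrow> has_partial f i (f' i y) y" "\<And>i. continuous_on S (f' i)"
    and \<gamma>: "\<And>i. ((\<lambda>s. \<gamma> s $ i) has_real_derivative \<gamma>' $ i) (at t)"
  shows "((\<lambda>s. f (\<gamma> s)) has_real_derivative (\<Sum>i\<in>UNIV. \<gamma>' $ i * f' i (\<gamma> t))) (at t)"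
proof -
  have "(\<gamma> has_derivative (\<lambda>h. \<chi> i. \<gamma>' $ i * h)) (at t)"
    by (subst has_derivative_componentwise_within)
      (use \<gamma> in \<open>auto simp: has_field_derivative_def Basis_vec_def inner_axis\<close>)
  from has_derivative_compose[OF this has_derivative_of_partials[OF assms(1-4)]]
  show ?thesis
    unfolding has_field_derivative_def
    by (rule has_derivative_eq_rhs) (auto simp: sum_distrib_right sum_distrib_left ac_simps)
qed

lemma smooth_on_partials:
  assumes "smooth_on S f" "open S"
  obtains f' where "\<And>i. smooth_on S (f' i)" "\<And>i x. x \<in> S \<Longrightarrow> has_partial f i (f' i x) x"
  using smooth_on_partial[OF assms] by metis

text \<open>The classical flat function exp(-1/t), extended by zero, times a power of 1/t. The power
  makes the family closed under differentiation up to linear combinations; k = 0 is the profile of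
  the bump function.\<close>

definition flat_exp :: "nat \<Rightarrow> real \<Rightarrow> real" where
  "flat_exp k t = (if t > 0 then (1 / t) ^ k * exp (- (1 / t)) else 0)"

lemma tendsto_flat_exp_0: "(flat_exp k \<longlongrightarrow> 0) (at 0)"
proof -
  \<comment> \<open>Substituting s = 1/t turns the limit from the right into that of s^k / exp s at
    infinity.\<close>
  have "((\<lambda>t. inverse t ^ k / exp (inverse t)) \<longlongrightarrow> (0::real)) (at_right 0)"
    by (rule filterlim_compose[OF tendsto_power_div_exp_0 filterlim_inverse_at_top_right])
  then have "(flat_exp k \<longlongrightarrow> 0) (at_right 0)"
    by (rule Lim_transform_eventually)
      (auto simp: flat_exp_def eventually_at_filter exp_minus field_simps)
  moreover have "(flat_exp k \<longlongrightarrow> 0) (at_left 0)"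
    by (rule Lim_transform_eventually[OF tendsto_const])
      (auto simp: flat_exp_def eventually_at_filter)
  ultimately show ?thesis by (simp add: filterlim_split_at)
qed

lemma DERIV_flat_exp:
  "(flat_exp k has_real_derivative flat_exp (k + 2) t - real k * flat_exp (k + 1) t) (at t)"
proof (cases t "0::real" rule: linorder_cases)
  case greater
  have "((\<lambda>t. (1 / t) ^ k * exp (- (1 / t))) has_real_derivative
      flat_exp (k + 2) t - real k * flat_exp (k + 1) t) (at t)"
    using greater
    by (cases k)
      (auto intro!: derivative_eq_intros simp: flat_exp_def field_simps power2_eq_square,
        metis One_nat_def power_eq_if)
  then show ?thesis
  proof (rule has_field_derivative_transform_within_open)
    show "open {0::real<..}" by simp
  qed (use greater in \<open>auto simp: flat_exp_def\<close>)
next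
  case less
  have "((\<lambda>t. 0) has_real_derivative flat_exp (k + 2) t - real k * flat_exp (k + 1) t) (at t)"
    using less by (simp add: flat_exp_def)
  then show ?thesis
  proof (rule has_field_derivative_transform_within_open)
    show "open {..<0::real}" by simp
  qed (use less in \<open>auto simp: flat_exp_def\<close>)
next
  case equal
  \<comment> \<open>At 0 the difference quotient of \<open>flat_exp k\<close> is
    \<open>flat_exp (k + 1)\<close> itself, even for h = 0 because 0 / 0 = 0, and its limit is
    already known.\<close>
  have "flat_exp (k + 1) = (\<lambda>h. (flat_exp k (0 + h) - flat_exp k 0) / h)"
    by (auto simp: flat_exp_def fun_eq_iff)
  with tendsto_flat_exp_0[of "k + 1"] show ?thesis
    unfolding DERIV_def using equal by (simp add: flat_exp_def)
qed

section \<open>Rules for partial derivatives and closure properties of smooth functions\<close>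

lemma has_partial_add:
  "has_partial f i a x \<Longrightarrow> has_partial g i b x \<Longrightarrow> has_partial (\<lambda>y. f y + g y) i (a + b) x"
  unfolding has_partial_def by (rule DERIV_add)

lemma has_partial_mult:
  "has_partial f i a x \<Longrightarrow> has_partial g i b x \<Longrightarrow>
    has_partial (\<lambda>y. f y * g y) i (a * g x + b * f x) x"
  unfolding has_partial_def using DERIV_mult by fastforce

lemma has_partial_chain:
  assumes "has_partial f i a x" "(\<phi> has_real_derivative b) (at (f x))"
  shows "has_partial (\<lambda>y. \<phi> (f y)) i (b * a) x"
  using assms unfolding has_partial_def
  by (intro DERIV_chain2[where f = \<phi> and g = "\<lambda>t. f (x + t *\<^sub>R axis i 1)"]) simp_all

lemma has_partial_const: "has_partial (\<lambda>y. c) i 0 x"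
  unfolding has_partial_def by simp

lemma has_partial_coord: "has_partial (\<lambda>y. y $ j) i (if i = j then 1 else 0) x"
  unfolding has_partial_def by (auto intro!: derivative_eq_intros simp: axis_def)

lemma smooth_on_const [simp]: "smooth_on S (\<lambda>x. c)"
  by (rule smooth_on_coinduct[where P = "\<lambda>f. \<exists>c. f = (\<lambda>x. c)"])
    (use has_partial_const in \<open>blast intro: continuous_on_const\<close>)+

lemma smooth_on_coord [simp]: "smooth_on S (\<lambda>x. x $ j)"
proof (rule smooth_on_coinduct[where P = "\<lambda>f. f = (\<lambda>x. x $ j) \<or> (\<exists>c. f = (\<lambda>x. c))"])
  fix f :: "real^'a \<Rightarrow> real" and i
  assume f: "f = (\<lambda>x. x $ j) \<or> (\<exists>c. f = (\<lambda>x. c))"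
  show "continuous_on S f" using f by (auto intro!: continuous_intros)
  show "\<exists>f'. (f' = (\<lambda>x. x $ j) \<or> (\<exists>c. f' = (\<lambda>x. c))) \<and> (\<forall>x\<in>S. has_partial f i (f' x) x)"
    using f has_partial_coord has_partial_const by metis
qed simp

text \<open>A partial derivative of a product or composition is a sum of products again, so no single one
  of these operations yields an invariant for coinduction; the algebra that they generate together
  does.\<close>

inductive smooth_closure :: "(real^'n) set \<Rightarrow> (real^'n \<Rightarrow> real) \<Rightarrow> bool" for S where
  base: "smooth_on S f \<Longrightarrow> smooth_closure S f"
| add: "smooth_closure S f \<Longrightarrow> smooth_closure S g \<Longrightarrow> smooth_closure S (\<lambda>x. f x + g x)"
| mult: "smooth_closure S f \<Longrightarrow> smooth_closure S g \<Longrightarrow> smooth_closure S (\<lambda>x. f x * g x)"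
| inverse: "smooth_closure S f \<Longrightarrow> (\<And>x. x \<in> S \<Longrightarrow> f x \<noteq> 0) \<Longrightarrow> smooth_closure S (\<lambda>x. inverse (f x))"
| compose: "smooth_on T F \<Longrightarrow> open T \<Longrightarrow> (\<And>x. x \<in> S \<Longrightarrow> \<tau> x \<in> T) \<Longrightarrow>
    (\<And>j. smooth_on S (\<lambda>x. \<tau> x $ j)) \<Longrightarrow> smooth_closure S (\<lambda>x. F (\<tau> x :: real^'n))"
| flat_exp: "smooth_closure S f \<Longrightarrow> smooth_closure S (\<lambda>x. flat_exp k (f x))"

lemma smooth_closure_sum:
  assumes "\<And>i. i \<in> I \<Longrightarrow> smooth_closure S (f i)"
  shows "smooth_closure S (\<lambda>x. \<Sum>i\<in>I. f i x)"
  using assms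
  by (induction I rule: infinite_finite_induct)
    (auto intro: smooth_closure.base smooth_closure.add)

text \<open>Rule induction shows that \<open>smooth_closure\<close> is an invariant for coinduction.
  In the composition case the chain rule yields a sum of products of a derivative of a component of
  \<tau> and a derivative of F composed with \<tau>; the former is smooth on S and the latter is a
  composition again, so the sum stays in the class.\<close>

lemma smooth_closure_step:
  assumes "smooth_closure S f" "open S"
  shows "continuous_on S f \<and> (\<forall>i. \<exists>f'. smooth_closure S f' \<and> (\<forall>x\<in>S. has_partial f i (f' x) x))"
  using assms(1)
proof induction
  case (base f)
  then show ?case
    using smooth_on_imp_continuous_on smooth_on_partial[OF _ assms(2)] smooth_closure.base by metis
next
  case (add f g)
  show ?case
  proof (intro conjI allI)
    fix i
    from add.IH obtain f' g' where "smooth_closure S f'" "\<forall>x\<in>S. has_partial f i (f' x) x"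
      "smooth_closure S g'" "\<forall>x\<in>S. has_partial g i (g' x) x" by blast
    then show "\<exists>f'. smooth_closure S f' \<and> (\<forall>x\<in>S. has_partial (\<lambda>x. f x + g x) i (f' x) x)"
      by (intro exI[of _ "\<lambda>x. f' x + g' x"]) (auto intro: smooth_closure.add has_partial_add)
  qed (use add.IH in \<open>blast intro: continuous_on_add\<close>)
next
  case (mult f g)
  show ?case
  proof (intro conjI allI)
    fix i
    from mult.IH obtain f' g' where "smooth_closure S f'" "\<forall>x\<in>S. has_partial f i (f' x) x"
      "smooth_closure S g'" "\<forall>x\<in>S. has_partial g i (g' x) x" by blast
    with mult.hyps show "\<exists>f'. smooth_closure S f' \<and> (\<forall>x\<in>S. has_partial (\<lambda>x. f x * g x) i (f' x) x)"
      by (intro exI[of _ "\<lambda>x. f' x * g x + g' x * f x"])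
        (auto intro: smooth_closure.add smooth_closure.mult has_partial_mult)
  qed (use mult.IH in \<open>blast intro: continuous_on_mult\<close>)
next
  case (inverse f)
  show ?case
  proof (intro conjI allI)
    show "continuous_on S (\<lambda>x. inverse (f x))"
      using inverse by (intro continuous_on_inverse) auto
    fix i
    from inverse.IH obtain f' where f': "smooth_closure S f'" "\<forall>x\<in>S. has_partial f i (f' x) x" by blast
    show "\<exists>f'. smooth_closure S f' \<and> (\<forall>x\<in>S. has_partial (\<lambda>x. inverse (f x)) i (f' x) x)"
    proof (intro exI[of _ "\<lambda>x. (- 1) * (inverse (f x) * inverse (f x)) * f' x"] conjI ballI)
      show "smooth_closure S (\<lambda>x. (- 1) * (inverse (f x) * inverse (f x)) * f' x)"
        using inverse f' smooth_closure.inverse[OF inverse.hyps]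
        by (intro smooth_closure.mult) (auto intro: smooth_closure.base)
      fix x assume x: "x \<in> S"
      show "has_partial (\<lambda>x. inverse (f x)) i ((- 1) * (inverse (f x) * inverse (f x)) * f' x) x"
        by (rule has_partial_chain) (use f' x inverse.hyps in \<open>auto intro!: derivative_eq_intros\<close>)
    qed
  qed
next
  case (compose T F \<tau>)
  obtain F' where F': "\<And>i. smooth_on T (F' i)" "\<And>i x. x \<in> T \<Longrightarrow> has_partial F i (F' i x) x"
    using smooth_on_partials[OF compose(1,2)] by metis
  show ?case
  proof (intro conjI allI)
    have "continuous_on S (\<lambda>x. \<chi> j. \<tau> x $ j)"
      using compose(4) by (intro continuous_on_vec_lambda) (rule smooth_on_imp_continuous_on)
    then have "continuous_on S \<tau>" by simp
    then show "continuous_on S (\<lambda>x. F (\<tau> x))"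
      using compose(3) by (intro continuous_on_compose2[OF smooth_on_imp_continuous_on[OF compose(1)]]) auto
    fix i
    have "\<forall>j. \<exists>t. smooth_on S t \<and> (\<forall>x\<in>S. has_partial (\<lambda>x. \<tau> x $ j) i (t x) x)"
      using smooth_on_partial[OF compose(4) assms(2)] by blast
    from choice[OF this] obtain \<tau>' where \<tau>': "\<And>j. smooth_on S (\<tau>' j)"
      "\<And>j x. x \<in> S \<Longrightarrow> has_partial (\<lambda>x. \<tau> x $ j) i (\<tau>' j x) x" by blast
    show "\<exists>f'. smooth_closure S f' \<and> (\<forall>x\<in>S. has_partial (\<lambda>x. F (\<tau> x)) i (f' x) x)"
    proof (intro exI[of _ "\<lambda>x. \<Sum>j\<in>UNIV. \<tau>' j x * F' j (\<tau> x)"] conjI ballI)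
      show "smooth_closure S (\<lambda>x. \<Sum>j\<in>UNIV. \<tau>' j x * F' j (\<tau> x))"
        by (intro smooth_closure_sum smooth_closure.mult)
          (use \<tau>' F' compose in \<open>blast intro: smooth_closure.base smooth_closure.compose\<close>)+
      fix x assume x: "x \<in> S"
      have "((\<lambda>s. F (\<tau> (x + s *\<^sub>R axis i 1))) has_real_derivative
          (\<Sum>j\<in>UNIV. (\<chi> j. \<tau>' j x) $ j * F' j (\<tau> (x + 0 *\<^sub>R axis i 1)))) (at 0)"
        by (rule has_real_derivative_along_curve[OF compose(2)])
          (use F' smooth_on_imp_continuous_on[OF F'(1)] \<tau>'(2)[OF x] compose(3)[OF x] in \<open>auto simp: has_partial_def\<close>)
      then show "has_partial (\<lambda>x. F (\<tau> x)) i (\<Sum>j\<in>UNIV. \<tau>' j x * F' j (\<tau> x)) x"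
        by (simp add: has_partial_def)
    qed
  qed
next
  case (flat_exp f k)
  show ?case
  proof (intro conjI allI)
    have "continuous_on UNIV (flat_exp k)"
      using DERIV_flat_exp DERIV_isCont continuous_at_imp_continuous_on by metis
    then show "continuous_on S (\<lambda>x. flat_exp k (f x))"
      using flat_exp.IH by (auto intro: continuous_on_compose2)
    fix i
    from flat_exp.IH obtain f' where f': "smooth_closure S f'" "\<forall>x\<in>S. has_partial f i (f' x) x" by blast
    show "\<exists>f'. smooth_closure S f' \<and> (\<forall>x\<in>S. has_partial (\<lambda>x. flat_exp k (f x)) i (f' x) x)"
    proof (intro exI[of _ "\<lambda>x. (flat_exp (k + 2) (f x) + (- real k) * flat_exp (k + 1) (f x)) * f' x"]
        conjI ballI)
      show "smooth_closure S (\<lambda>x. (flat_exp (k + 2) (f x) + (- real k) * flat_exp (k + 1) (f x)) * f' x)"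
        using f'(1) flat_exp.hyps
        by (intro smooth_closure.mult smooth_closure.add smooth_closure.flat_exp
            smooth_closure.base[OF smooth_on_const])
      fix x assume x: "x \<in> S"
      show "has_partial (\<lambda>x. flat_exp k (f x)) i
          ((flat_exp (k + 2) (f x) + (- real k) * flat_exp (k + 1) (f x)) * f' x) x"
        by (rule has_partial_chain) (use f' x DERIV_flat_exp[of k "f x"] in auto)
    qed
  qed
qed

lemma smooth_on_if_smooth_closure:
  assumes "smooth_closure S f" "open S"
  shows "smooth_on S f"
  by (rule smooth_on_coinduct[where P = "smooth_closure S"])
    (use assms smooth_closure_step in blast)+

lemma
  assumes "open S"
  shows smooth_on_add: "smooth_on S f \<Longrightarrow> smooth_on S g \<Longrightarrow> smooth_on S (\<lambda>x. f x + g x)"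
    and smooth_on_mult: "smooth_on S f \<Longrightarrow> smooth_on S g \<Longrightarrow> smooth_on S (\<lambda>x. f x * g x)"
    and smooth_on_inverse:
      "smooth_on S f \<Longrightarrow> (\<And>x. x \<in> S \<Longrightarrow> f x \<noteq> 0) \<Longrightarrow> smooth_on S (\<lambda>x. inverse (f x))"
    and smooth_on_flat_exp: "smooth_on S f \<Longrightarrow> smooth_on S (\<lambda>x. flat_exp k (f x))"
  by (rule smooth_on_if_smooth_closure[OF _ assms],
      erule smooth_closure.intros(2-4,6)[OF smooth_closure.base], (blast intro: smooth_closure.base)?)+

lemma smooth_on_compose:
  fixes \<tau> :: "real^'n \<Rightarrow> real^'n"
  assumes "open S" "smooth_on T F" "open T" "\<And>x. x \<in> S \<Longrightarrow> \<tau> x \<in> T"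
    "\<And>j. smooth_on S (\<lambda>x. \<tau> x $ j)"
  shows "smooth_on S (\<lambda>x. F (\<tau> x))"
  by (rule smooth_on_if_smooth_closure[OF smooth_closure.compose[OF assms(2-5)] assms(1)])

lemma smooth_on_sum:
  assumes "open S" "\<And>i. i \<in> I \<Longrightarrow> smooth_on S (f i)"
  shows "smooth_on S (\<lambda>x. \<Sum>i\<in>I. f i x)"
  by (rule smooth_on_if_smooth_closure[OF smooth_closure_sum])
    (use assms smooth_closure.base in auto)

text \<open>Differentiating under the integral in the variable y brings down a factor t. With the
  power of t and the function H left arbitrary, these integrals are closed under partial
  derivatives, which is the coinduction invariant.\<close>

lemma smooth_on_integral_segment:
  fixes H :: "real^'n \<Rightarrow> real"
  assumes "smooth_on C H" "open C" "convex C" "c \<in> C"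
  shows "smooth_on C (\<lambda>y. integral (cbox 0 1) (\<lambda>t. t ^ k * H (c + t *\<^sub>R (y - c))))"
proof -
  define I where "I k H y = integral (cbox 0 1) (\<lambda>t::real. t ^ k * H (c + t *\<^sub>R (y - c)))"
    for k :: nat and H :: "real^'n \<Rightarrow> real" and y
  have seg: "c + t *\<^sub>R (y - c) \<in> C" if "y \<in> C" "t \<in> cbox 0 1" for t y
  proof -
    have "(1 - t) *\<^sub>R c + t *\<^sub>R y \<in> C"
      by (rule convexD_alt) (use assms that in auto)
    then show ?thesis by (simp add: algebra_simps)
  qed
  show ?thesis
  proof (rule smooth_on_coinduct[where P = "\<lambda>f. \<exists>k H. smooth_on C H \<and> f = I k H"])
    fix f assume "\<exists>k H. smooth_on C H \<and> f = I k H"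
    then obtain k H where H: "smooth_on C H" and f: "f = I k H" by blast
    have cont: "continuous_on (C \<times> cbox 0 1) (\<lambda>(y, t::real). t ^ l * G (c + t *\<^sub>R (y - c)))"
      if "smooth_on C G" for G l
      unfolding case_prod_beta
      by (intro continuous_intros continuous_on_compose2[OF smooth_on_imp_continuous_on[OF that]])
        (use seg in auto)
    show "continuous_on C f"
      unfolding f I_def by (rule integral_continuous_on_param[OF cont[OF H]])
    obtain H' where H': "\<And>i. smooth_on C (H' i)" "\<And>i x. x \<in> C \<Longrightarrow> has_partial H i (H' i x) x"
      using smooth_on_partials[OF H assms(2)] by metis
    fix i
    have "has_partial (I k H) i (I (Suc k) (H' i) y) y" if y: "y \<in> C" for y
    proof -
      \<comment> \<open>The Leibniz rule asks for a convex set of parameters, so s is confined to a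
        ball on which the shifted point stays in C.\<close>
      have "open ((\<lambda>s::real. y + s *\<^sub>R axis i 1) -` C)"
        by (intro open_vimage continuous_intros assms)
      moreover have "0 \<in> (\<lambda>s::real. y + s *\<^sub>R axis i 1) -` C"
        using y by simp
      ultimately obtain \<epsilon> where "\<epsilon> > 0" "ball 0 \<epsilon> \<subseteq> (\<lambda>s::real. y + s *\<^sub>R axis i 1) -` C"
        using open_contains_ball by metis
      then have \<epsilon>: "\<epsilon> > 0" "\<And>s. s \<in> ball 0 \<epsilon> \<Longrightarrow> y + s *\<^sub>R axis i 1 \<in> C"
        by auto
      have ball: "continuous_on (ball 0 \<epsilon> \<times> cbox 0 1)
          (\<lambda>(s, t). t ^ l * G (c + t *\<^sub>R (y + s *\<^sub>R axis i 1 - c)))"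
        if "smooth_on C G" for G l
        unfolding case_prod_beta
        by (intro continuous_intros continuous_on_compose2[OF smooth_on_imp_continuous_on[OF that]])
          (use seg \<epsilon> in auto)
      have "((\<lambda>s. I k H (y + s *\<^sub>R axis i 1)) has_field_derivative
          integral (cbox 0 1) (\<lambda>t. t ^ Suc k * H' i (c + t *\<^sub>R (y + 0 *\<^sub>R axis i 1 - c)))) (at 0 within ball 0 \<epsilon>)"
        unfolding I_def
      proof (rule leibniz_rule_field_derivative)
        fix s t :: real assume s: "s \<in> ball 0 \<epsilon>" and t: "t \<in> cbox 0 1"
        have "((\<lambda>s. H (c + t *\<^sub>R (y + s *\<^sub>R axis i 1 - c))) has_real_derivative
            (\<Sum>j\<in>UNIV. axis i t $ j * H' j (c + t *\<^sub>R (y + s *\<^sub>R axis i 1 - c)))) (at s)"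
          by (rule has_real_derivative_along_curve[OF assms(2)])
            (use seg[OF \<epsilon>(2)[OF s] t] H' smooth_on_imp_continuous_on[OF H'(1)] in
              \<open>auto intro!: derivative_eq_intros simp: axis_def\<close>)
        also have "(\<Sum>j\<in>UNIV. axis i t $ j * H' j (c + t *\<^sub>R (y + s *\<^sub>R axis i 1 - c)))
            = (\<Sum>j\<in>UNIV. if j = i then t * H' j (c + t *\<^sub>R (y + s *\<^sub>R axis i 1 - c)) else 0)"
          by (intro sum.cong) (auto simp: axis_def)
        also have "\<dots> = t * H' i (c + t *\<^sub>R (y + s *\<^sub>R axis i 1 - c))" by simp
        finally have "((\<lambda>s. t ^ k * H (c + t *\<^sub>R (y + s *\<^sub>R axis i 1 - c))) has_real_derivative
            t ^ k * (t * H' i (c + t *\<^sub>R (y + s *\<^sub>R axis i 1 - c)))) (at s)"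
          by (rule DERIV_cmult)
        then show "((\<lambda>s. t ^ k * H (c + t *\<^sub>R (y + s *\<^sub>R axis i 1 - c))) has_real_derivative
            t ^ Suc k * H' i (c + t *\<^sub>R (y + s *\<^sub>R axis i 1 - c))) (at s within ball 0 \<epsilon>)"
          by (simp add: ac_simps has_field_derivative_at_within)
      next
        fix s :: real assume "s \<in> ball 0 \<epsilon>"
        then have "continuous_on (cbox 0 1) (\<lambda>t. t ^ k * H (c + t *\<^sub>R (y + s *\<^sub>R axis i 1 - c)))"
          by (intro continuous_intros continuous_on_compose2[OF smooth_on_imp_continuous_on[OF H]])
            (use seg \<epsilon> in auto)
        then show "(\<lambda>t. t ^ k * H (c + t *\<^sub>R (y + s *\<^sub>R axis i 1 - c))) integrable_on cbox 0 1"
          by (rule integrable_continuous)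
      qed (use ball[OF H'(1), of "Suc k" i] \<epsilon>(1) in auto)
      then show ?thesis
        using \<epsilon>(1) by (simp add: has_partial_def I_def at_within_open[of 0 "ball 0 \<epsilon>"])
    qed
    then show "\<exists>f'. (\<exists>k H. smooth_on C H \<and> f' = I k H) \<and> (\<forall>x\<in>C. has_partial f i (f' x) x)"
      using H'(1) unfolding f by blast
  qed (intro exI[of _ k] exI[of _ H], use assms(1) in \<open>auto simp: I_def\<close>)
qed

text \<open>Integrate the derivative of F along the segment from c to y and pull the coordinates of
  y - c out: \<open>h i y\<close> is the mean of the i-th partial derivative over the segment. At y
  = c the integrand is constant, hence the last claim. The factor \<open>t ^ 0\<close> in
  \<open>h_def\<close> only matches the preceding lemma.\<close>

lemma hadamard:
  fixes F :: "real^'n \<Rightarrow> real"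
  assumes "smooth_on C F" "open C" "convex C" "c \<in> C"
  obtains h where "\<And>i. smooth_on C (h i)"
    "\<And>y. y \<in> C \<Longrightarrow> F y = F c + (\<Sum>i\<in>UNIV. (y $ i - c $ i) * h i y)"
    "\<And>i. has_partial F i (h i c) c"
proof -
  obtain F' where F': "\<And>i. smooth_on C (F' i)" "\<And>i x. x \<in> C \<Longrightarrow> has_partial F i (F' i x) x"
    using smooth_on_partials[OF assms(1,2)] by metis
  define h where "h i y = integral (cbox 0 1) (\<lambda>t::real. t ^ 0 * F' i (c + t *\<^sub>R (y - c)))" for i y
  show ?thesis
  proof
    show "smooth_on C (h i)" for i
      unfolding h_def by (rule smooth_on_integral_segment) (use F' assms in auto)
    show "has_partial F i (h i c) c" for i
      using F'(2)[OF assms(4)] by (simp add: h_def)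
    fix y assume y: "y \<in> C"
    have seg: "c + t *\<^sub>R (y - c) \<in> C" if "t \<in> {0..1}" for t
    proof -
      have "(1 - t) *\<^sub>R c + t *\<^sub>R y \<in> C"
        by (rule convexD_alt) (use assms that y in auto)
      then show ?thesis by (simp add: algebra_simps)
    qed
    have ftc: "((\<lambda>t. \<Sum>i\<in>UNIV. (y - c) $ i * F' i (c + t *\<^sub>R (y - c))) has_integral
        F (c + 1 *\<^sub>R (y - c)) - F (c + 0 *\<^sub>R (y - c))) {0..1}"
    proof (rule fundamental_theorem_of_calculus)
      fix t :: real assume "t \<in> {0..1}"
      then have "((\<lambda>t. F (c + t *\<^sub>R (y - c))) has_real_derivative
          (\<Sum>i\<in>UNIV. (y - c) $ i * F' i (c + t *\<^sub>R (y - c)))) (at t)"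
        by (intro has_real_derivative_along_curve[OF assms(2)])
          (use seg F' smooth_on_imp_continuous_on[OF F'(1)] in \<open>auto intro!: derivative_eq_intros\<close>)
      then show "((\<lambda>t. F (c + t *\<^sub>R (y - c))) has_vector_derivative
          (\<Sum>i\<in>UNIV. (y - c) $ i * F' i (c + t *\<^sub>R (y - c)))) (at t within {0..1})"
        by (simp add: has_field_derivative_at_within has_real_derivative_iff_has_vector_derivative[symmetric])
    qed simp
    have "((\<lambda>t. \<Sum>i\<in>UNIV. (y - c) $ i * F' i (c + t *\<^sub>R (y - c))) has_integral
        (\<Sum>i\<in>UNIV. (y - c) $ i * h i y)) {0..1}"
    proof (intro has_integral_sum has_integral_mult_right)
      fix i
      have "continuous_on {0..1} (\<lambda>t. F' i (c + t *\<^sub>R (y - c)))"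
        by (intro continuous_intros continuous_on_compose2[OF smooth_on_imp_continuous_on[OF F'(1)]])
          (use seg in auto)
      then show "((\<lambda>t. F' i (c + t *\<^sub>R (y - c))) has_integral h i y) {0..1}"
        unfolding h_def by (simp add: integrable_continuous_interval integrable_integral)
    qed simp
    from has_integral_unique[OF ftc this]
    show "F y = F c + (\<Sum>i\<in>UNIV. (y $ i - c $ i) * h i y)" by simp
  qed
qed

subsection \<open>Smooth functions, tangent vectors and local frames on a manifold\<close>

locale smooth_manifold =
  fixes A :: "('a::{t2_space,second_countable_topology} set \<times> ('a \<Rightarrow> real^'n::finite)) set"
  assumes atlas: "smooth_atlas A"
begin

abbreviation "smooth \<equiv> smooth_fun A"
abbreviation "T \<equiv> tangent_space A"
abbreviation "VF \<equiv> vector_fields A"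

lemma
  assumes "(U, \<phi>) \<in> A"
  shows chart_open: "open U" and chart_open_image: "open (\<phi> ` U)" and chart_inj: "inj_on \<phi> U"
    and chart_continuous: "continuous_on U \<phi>"
    and chart_continuous_inv: "continuous_on (\<phi> ` U) (inv_into U \<phi>)"
  using assms atlas unfolding smooth_atlas_def chart_def by blast+

lemma chart_exists: obtains U \<phi> where "(U, \<phi>) \<in> A" "p \<in> U"
proof -
  have "p \<in> \<Union> (fst ` A)"
    using atlas unfolding smooth_atlas_def by blast
  then show ?thesis using that by force
qed

lemma transition_smooth:
  assumes "(U, \<phi>) \<in> A" "(V, \<psi>) \<in> A"
  shows "smooth_on (\<phi> ` (U \<inter> V)) (\<lambda>x. \<psi> (inv_into U \<phi> x) $ i)"
proof -
  have "\<forall>(U, \<phi>)\<in>A. \<forall>(V, \<psi>)\<in>A. \<forall>i. smooth_on (\<phi> ` (U \<inter> V)) (\<lambda>x. \<psi> (inv_into U \<phi> x) $ i)"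
    using atlas unfolding smooth_atlas_def by blast
  from bspec[OF this assms(1)] have
    "\<forall>(V, \<psi>)\<in>A. \<forall>i. smooth_on (\<phi> ` (U \<inter> V)) (\<lambda>x. \<psi> (inv_into U \<phi> x) $ i)" by simp
  from bspec[OF this assms(2)] show ?thesis by simp
qed

lemma chart_open_preimage:
  assumes "(U, \<phi>) \<in> A" "open W"
  shows "open {y \<in> \<phi> ` U. inv_into U \<phi> y \<in> W}"
proof -
  have "open (inv_into U \<phi> -` W \<inter> \<phi> ` U)"
    using continuous_on_open_vimage[OF chart_open_image[OF assms(1)]]
      chart_continuous_inv[OF assms(1)] assms(2) by blast
  moreover have "inv_into U \<phi> -` W \<inter> \<phi> ` U = {y \<in> \<phi> ` U. inv_into U \<phi> y \<in> W}" by auto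
  ultimately show ?thesis by simp
qed

section \<open>Smooth functions on the manifold, and extension by zero\<close>

lemma smooth_fun_iff:
  "smooth f \<longleftrightarrow> (\<forall>U \<phi>. (U, \<phi>) \<in> A \<longrightarrow> smooth_on (\<phi> ` U) (\<lambda>y. f (inv_into U \<phi> y)))"
  unfolding smooth_fun_def o_def by auto

lemma smooth_const [simp]: "smooth (\<lambda>p. c)"
  by (simp add: smooth_fun_iff)

lemma smooth_add: "smooth f \<Longrightarrow> smooth g \<Longrightarrow> smooth (\<lambda>p. f p + g p)"
  by (simp add: smooth_fun_iff smooth_on_add chart_open_image)

lemma smooth_mult: "smooth f \<Longrightarrow> smooth g \<Longrightarrow> smooth (\<lambda>p. f p * g p)"
  by (simp add: smooth_fun_iff smooth_on_mult chart_open_image)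

lemma smooth_diff: "smooth f \<Longrightarrow> smooth g \<Longrightarrow> smooth (\<lambda>p. f p - g p)"
  using smooth_add[of f "\<lambda>p. (- 1) * g p"] smooth_mult[of "\<lambda>p. - 1" g] by simp

lemma smooth_sum: "(\<And>i. i \<in> I \<Longrightarrow> smooth (f i)) \<Longrightarrow> smooth (\<lambda>p. \<Sum>i\<in>I. f i p)"
  by (induction I rule: infinite_finite_induct) (auto intro: smooth_add)

lemma smooth_prod: "(\<And>i. i \<in> I \<Longrightarrow> smooth (f i)) \<Longrightarrow> smooth (\<lambda>p. \<Prod>i\<in>I. f i p)"
  by (induction I rule: infinite_finite_induct) (auto intro: smooth_mult)

lemma smooth_det:
  fixes M :: "'a \<Rightarrow> real^'k::finite^'k"
  assumes "\<And>i j. smooth (\<lambda>p. M p $ i $ j)"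
  shows "smooth (\<lambda>p. det (M p))"
  unfolding det_def by (intro smooth_sum smooth_mult smooth_prod smooth_const assms)

lemmas smooth_intros = smooth_const smooth_add smooth_mult smooth_diff smooth_sum

text \<open>A chart-free test for smoothness: since d and u are global, the open set where d is
  nonzero serves as the neighbourhood on which h is the quotient u / d. It is made for solutions
  given by Cramer's rule.\<close>

lemma smooth_if_local_quotient:
  assumes "\<And>p. \<exists>d u. smooth d \<and> smooth u \<and> d p \<noteq> 0 \<and> (\<forall>q. d q \<noteq> 0 \<longrightarrow> d q * h q = u q)"
  shows "smooth h"
  unfolding smooth_fun_iff
proof (intro allI impI smooth_on_local)
  fix U \<phi> y assume U: "(U, \<phi>) \<in> A" and y: "y \<in> \<phi> ` U"
  let ?inv = "inv_into U \<phi>"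
  from assms[of "?inv y"] obtain d u where du: "smooth d" "smooth u" "d (?inv y) \<noteq> 0"
    "\<And>q. d q \<noteq> 0 \<Longrightarrow> d q * h q = u q" by blast
  define S where "S = (\<lambda>y. d (?inv y)) -` (- {0}) \<inter> \<phi> ` U"
  have d: "smooth_on (\<phi> ` U) (\<lambda>y. d (?inv y))" and u: "smooth_on (\<phi> ` U) (\<lambda>y. u (?inv y))"
    using du U by (auto simp: smooth_fun_iff)
  have S: "open S"
    unfolding S_def
    using continuous_on_open_vimage[OF chart_open_image[OF U]] smooth_on_imp_continuous_on[OF d]
    by (metis open_Compl closed_singleton)
  have sub: "S \<subseteq> \<phi> ` U" by (auto simp: S_def)
  have "smooth_on S (\<lambda>y. u (?inv y) * inverse (d (?inv y)))"
    by (intro smooth_on_mult smooth_on_inverse S smooth_on_subset[OF d sub] smooth_on_subset[OF u sub])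
      (auto simp: S_def)
  then have "smooth_on S (\<lambda>y. h (?inv y))"
    by (rule smooth_on_cong) (auto simp: S_def du(4)[symmetric])
  then show "\<exists>S. open S \<and> y \<in> S \<and> smooth_on S (\<lambda>y. h (?inv y))"
    using S y du(3) by (intro exI[of _ S]) (auto simp: S_def)
qed

definition extend_by_zero ::
  "'a set \<Rightarrow> ('a \<Rightarrow> real^'n) \<Rightarrow> (real^'n) set \<Rightarrow> (real^'n \<Rightarrow> real) \<Rightarrow> 'a \<Rightarrow> real" where
  "extend_by_zero U \<phi> S F p = (if p \<in> U \<and> \<phi> p \<in> S then F (\<phi> p) else 0)"

text \<open>The copy of K in the manifold is compact, hence closed because the space is Hausdorff.
  So near every point the function is either F after a smooth transition map or identically
  zero.\<close>

lemma smooth_extend_by_zero: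
  assumes U: "(U, \<phi>) \<in> A" and S: "open S" "S \<subseteq> \<phi> ` U" and F: "smooth_on S F"
    and K: "compact K" "K \<subseteq> S" and zero: "\<And>y. y \<in> S - K \<Longrightarrow> F y = 0"
  shows "smooth (extend_by_zero U \<phi> S F)"
  unfolding smooth_fun_iff
proof (intro allI impI smooth_on_local)
  fix V \<psi> y assume V: "(V, \<psi>) \<in> A" and y: "y \<in> \<psi> ` V"
  let ?inv = "inv_into V \<psi>" and ?f = "extend_by_zero U \<phi> S F"
  have inv_in: "?inv z \<in> V" if "z \<in> \<psi> ` V" for z
    using that by (rule inv_into_into)
  show "\<exists>W. open W \<and> y \<in> W \<and> smooth_on W (\<lambda>z. ?f (?inv z))"
  proof (cases "?inv y \<in> U \<and> \<phi> (?inv y) \<in> S")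
    case True
    have "open (\<phi> -` S \<inter> U)"
      using continuous_on_open_vimage[OF chart_open[OF U]] chart_continuous[OF U] S(1) by blast
    define W where "W = {z \<in> \<psi> ` V. ?inv z \<in> \<phi> -` S \<inter> U}"
    have W: "open W"
      unfolding W_def by (rule chart_open_preimage[OF V \<open>open (\<phi> -` S \<inter> U)\<close>])
    have "W \<subseteq> \<psi> ` (V \<inter> U)"
    proof
      fix z assume "z \<in> W"
      then have "z = \<psi> (?inv z)" "?inv z \<in> V \<inter> U"
        by (auto simp: W_def f_inv_into_f inv_in)
      then show "z \<in> \<psi> ` (V \<inter> U)" by blast
    qed
    then have "smooth_on W (\<lambda>z. F (\<phi> (?inv z)))"
      by (intro smooth_on_compose[OF W F S(1)] smooth_on_subset[OF transition_smooth[OF V U]])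
        (auto simp: W_def)
    then have "smooth_on W (\<lambda>z. ?f (?inv z))"
      by (rule smooth_on_cong) (auto simp: W_def extend_by_zero_def)
    then show ?thesis using W y True by (intro exI[of _ W]) (auto simp: W_def)
  next
    case False
    have "compact (inv_into U \<phi> ` K)"
      using K S(2) chart_continuous_inv[OF U]
      by (intro compact_continuous_image) (auto intro: continuous_on_subset)
    then have op: "open (- (inv_into U \<phi> ` K))"
      by (intro open_Compl compact_imp_closed)
    define W where "W = {z \<in> \<psi> ` V. ?inv z \<in> - (inv_into U \<phi> ` K)}"
    have W: "open W"
      unfolding W_def by (rule chart_open_preimage[OF V op])
    have eq: "?f q = 0" if "q \<notin> inv_into U \<phi> ` K" for q
    proof (cases "q \<in> U \<and> \<phi> q \<in> S")
      case True
      then have "\<phi> q \<notin> K"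
        using that inv_into_f_f[OF chart_inj[OF U]] by force
      then show ?thesis using zero True by (auto simp: extend_by_zero_def)
    qed (auto simp: extend_by_zero_def)
    have "smooth_on W (\<lambda>z. ?f (?inv z))"
      by (rule smooth_on_cong[OF smooth_on_const[of W 0]]) (auto simp: W_def eq)
    moreover have "?inv y \<notin> inv_into U \<phi> ` K"
    proof
      assume "?inv y \<in> inv_into U \<phi> ` K"
      then obtain k where "k \<in> K" "?inv y = inv_into U \<phi> k" by blast
      moreover from this have "k \<in> \<phi> ` U" "k \<in> S" using K S by auto
      ultimately show False
        using False by (auto simp: f_inv_into_f inv_into_into)
    qed
    ultimately show ?thesis using W y by (intro exI[of _ W]) (auto simp: W_def)
  qed
qed

section \<open>Tangent vectors and vector fields as derivations\<close>

lemma
  assumes "v \<in> T p"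
  shows tangent_nonsmooth: "\<not> smooth f \<Longrightarrow> v f = 0"
    and tangent_add: "smooth f \<Longrightarrow> smooth h \<Longrightarrow> v (\<lambda>q. f q + h q) = v f + v h"
    and tangent_scale: "smooth f \<Longrightarrow> v (\<lambda>q. c * f q) = c * v f"
    and tangent_mult: "smooth f \<Longrightarrow> smooth h \<Longrightarrow> v (\<lambda>q. f q * h q) = f p * v h + h p * v f"
  using assms unfolding tangent_space_def by blast+

lemma tangent_const: "v \<in> T p \<Longrightarrow> v (\<lambda>q. c) = 0"
  using tangent_mult[of v p "\<lambda>q. 1" "\<lambda>q. 1"] tangent_scale[of v p "\<lambda>q. 1" c] by simp

lemma tangent_sum:
  assumes "v \<in> T p" "\<And>i. i \<in> I \<Longrightarrow> smooth (f i)"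
  shows "v (\<lambda>q. \<Sum>i\<in>I. f i q) = (\<Sum>i\<in>I. v (f i))"
  using assms(2)
  by (induction I rule: infinite_finite_induct)
    (auto simp: tangent_const[OF assms(1)] tangent_add[OF assms(1)] smooth_sum)

lemma tangent_space_zero: "(\<lambda>f. 0) \<in> T p"
  unfolding tangent_space_def by simp

lemma tangent_space_add:
  assumes "v \<in> T p" "w \<in> T p"
  shows "(\<lambda>f. v f + w f) \<in> T p"
  using assms unfolding tangent_space_def mem_Collect_eq by (simp add: algebra_simps)

lemma tangent_space_scale:
  assumes "v \<in> T p"
  shows "(\<lambda>f. c * v f) \<in> T p"
  using assms unfolding tangent_space_def mem_Collect_eq by (simp add: algebra_simps)

lemma tangent_space_sum:
  assumes "\<And>i. i \<in> I \<Longrightarrow> v i \<in> T p"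
  shows "(\<lambda>f. \<Sum>i\<in>I. c i * v i f) \<in> T p"
  using assms
  by (induction I rule: infinite_finite_induct)
    (simp_all add: tangent_space_zero tangent_space_add[OF tangent_space_scale])

text \<open>Both definitions impose the same clauses, once as identities of functions and once at a
  point. Membership thus splits into a pointwise condition, to which the vector space structure of
  \<open>T p\<close> applies, and preservation of smoothness.\<close>

lemma vector_fields_iff:
  "X \<in> VF \<longleftrightarrow> (\<forall>p. at_pt X p \<in> T p) \<and> (\<forall>f. smooth f \<longrightarrow> smooth (X f))"
  unfolding vector_fields_def tangent_space_def at_pt_def mem_Collect_eq fun_eq_iff by blast

lemma at_pt_in_T: "X \<in> VF \<Longrightarrow> at_pt X p \<in> T p"
  by (simp add: vector_fields_iff)

lemma smooth_VF: "X \<in> VF \<Longrightarrow> smooth f \<Longrightarrow> smooth (X f)"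
  by (simp add: vector_fields_iff)

lemma
  assumes "X \<in> VF"
  shows VF_add: "smooth f \<Longrightarrow> smooth h \<Longrightarrow> X (\<lambda>q. f q + h q) p = X f p + X h p"
    and VF_mult: "smooth f \<Longrightarrow> smooth h \<Longrightarrow> X (\<lambda>q. f q * h q) p = f p * X h p + h p * X f p"
    and VF_scale: "smooth f \<Longrightarrow> X (\<lambda>q. c * f q) p = c * X f p"
    and VF_const: "X (\<lambda>q. c) p = 0"
    and VF_nonsmooth: "\<not> smooth f \<Longrightarrow> X f p = 0"
  using tangent_add[OF at_pt_in_T[OF assms, of p]] tangent_mult[OF at_pt_in_T[OF assms, of p]]
    tangent_scale[OF at_pt_in_T[OF assms, of p]] tangent_const[OF at_pt_in_T[OF assms, of p]]
    tangent_nonsmooth[OF at_pt_in_T[OF assms, of p]]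
  by (simp_all add: at_pt_def)

lemma vector_fields_module_op:
  assumes f: "smooth f" and "Z \<in> VF" "W \<in> VF"
  shows "(\<lambda>h q. f q * Z h q + W h q) \<in> VF"
  unfolding vector_fields_iff
proof (intro conjI allI impI)
  show "at_pt (\<lambda>h q. f q * Z h q + W h q) p \<in> T p" for p
    using tangent_space_add[OF tangent_space_scale[OF at_pt_in_T] at_pt_in_T] assms
    by (simp add: at_pt_def)
  show "smooth (\<lambda>q. f q * Z h q + W h q)" if "smooth h" for h
    by (intro smooth_add smooth_mult f smooth_VF[OF assms(2) that] smooth_VF[OF assms(3) that])
qed

lemma vector_fields_zero: "(\<lambda>h q. 0) \<in> VF"
  unfolding vector_fields_iff using tangent_space_zero by (simp add: at_pt_def)

lemma vector_fields_sum:
  assumes "\<And>i. i \<in> I \<Longrightarrow> smooth (f i)" "\<And>i. i \<in> I \<Longrightarrow> E i \<in> VF"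
  shows "(\<lambda>h q. \<Sum>i\<in>I. f i q * E i h q) \<in> VF"
  using assms
  by (induction I rule: infinite_finite_induct)
    (auto intro: vector_fields_zero vector_fields_module_op)

lemma lie_bracket_in_VF:
  assumes "X \<in> VF" "Y \<in> VF"
  shows "lie_bracket X Y \<in> VF"
  unfolding vector_fields_iff
proof (intro conjI allI impI)
  fix p
  show "at_pt (lie_bracket X Y) p \<in> T p"
    unfolding tangent_space_def at_pt_def lie_bracket_def mem_Collect_eq
  proof (intro conjI allI impI)
    fix f assume "\<not> smooth f"
    then have "X f = (\<lambda>q. 0)" "Y f = (\<lambda>q. 0)"
      using assms VF_nonsmooth by blast+
    then show "X (Y f) p - Y (X f) p = 0" by (simp add: VF_const assms)
  next
    fix f h assume fh: "smooth f" "smooth h"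
    have add: "X' (\<lambda>q. f q + h q) = (\<lambda>q. X' f q + X' h q)"
      and mult: "X' (\<lambda>q. f q * h q) = (\<lambda>q. f q * X' h q + h q * X' f q)" if "X' \<in> VF" for X'
      using VF_add[OF that fh] VF_mult[OF that fh] by (simp_all add: fun_eq_iff)
    show "X (Y (\<lambda>q. f q + h q)) p - Y (X (\<lambda>q. f q + h q)) p =
        X (Y f) p - Y (X f) p + (X (Y h) p - Y (X h) p)"
      using fh assms by (simp add: add smooth_VF VF_add[of X] VF_add[of Y])
    \<comment> \<open>The two mixed terms, with one derivative on each factor, are exchanged when
      \<open>X'\<close> and \<open>Y'\<close> are swapped, so they cancel in the bracket.\<close>
    have prod: "X' (Y' (\<lambda>q. f q * h q)) p = f p * X' (Y' h) p + Y' h p * X' f p + h p * X' (Y' f) p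
        + Y' f p * X' h p" if "X' \<in> VF" "Y' \<in> VF" for X' Y'
    proof -
      have "smooth (Y' f)" "smooth (Y' h)" using that fh smooth_VF by blast+
      then show ?thesis
        using that fh by (simp add: mult smooth_mult VF_add[of X'] VF_mult[of X'])
    qed
    show "X (Y (\<lambda>q. f q * h q)) p - Y (X (\<lambda>q. f q * h q)) p =
        f p * (X (Y h) p - Y (X h) p) + h p * (X (Y f) p - Y (X f) p)"
      unfolding prod[OF assms] prod[OF assms(2,1)] by (simp add: algebra_simps)
  next
    fix c f assume f: "smooth f"
    have scale: "X' (\<lambda>q. c * f q) = (\<lambda>q. c * X' f q)" if "X' \<in> VF" for X'
      using VF_scale[OF that f] by (simp add: fun_eq_iff)
    show "X (Y (\<lambda>q. c * f q)) p - Y (X (\<lambda>q. c * f q)) p = c * (X (Y f) p - Y (X f) p)"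
      by (simp add: scale VF_scale smooth_VF assms f algebra_simps)
  qed
next
  fix f assume "smooth f"
  then show "smooth (lie_bracket X Y f)"
    unfolding lie_bracket_def by (intro smooth_diff) (use assms smooth_VF in blast)+
qed

end

section \<open>Cut-off local frames\<close>

definition partial :: "(real^'n \<Rightarrow> real) \<Rightarrow> 'n \<Rightarrow> real^'n \<Rightarrow> real" where
  "partial f i x = (SOME d. has_partial f i d x)"

lemma partial_eq: "has_partial f i d x \<Longrightarrow> partial f i x = d"
  unfolding partial_def by (rule some_equality) (auto dest: has_partial_unique)

lemma
  assumes "smooth_on S f" "open S"
  shows has_partial_partial: "x \<in> S \<Longrightarrow> has_partial f i (partial f i x) x"
    and smooth_on_partial_deriv: "smooth_on S (partial f i)"
proof -
  obtain f' where f': "smooth_on S f'" "\<And>x. x \<in> S \<Longrightarrow> has_partial f i (f' x) x"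
    using smooth_on_partial[OF assms] by blast
  show "has_partial f i (partial f i x) x" if "x \<in> S"
    using f'(2)[OF that] partial_eq by metis
  show "smooth_on S (partial f i)"
    by (rule smooth_on_cong[OF f'(1)]) (metis f'(2) partial_eq)
qed

lemma has_partial_at_minimum:
  assumes "has_partial f i d x" "open S" "x \<in> S" "\<And>y. y \<in> S \<Longrightarrow> f x \<le> f y"
  shows "d = 0"
proof -
  have "\<forall>\<^sub>F t in nhds (0::real). f x \<le> f (x + t *\<^sub>R axis i 1)"
    using eventually_shift_in_open[OF assms(2,3), of i] by (rule eventually_mono) (rule assms(4))
  then obtain \<epsilon> where "\<epsilon> > 0" "\<And>t. dist t 0 < \<epsilon> \<Longrightarrow> f x \<le> f (x + t *\<^sub>R axis i 1)"
    unfolding eventually_nhds_metric by blast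
  then show ?thesis
    using DERIV_local_min[of "\<lambda>t. f (x + t *\<^sub>R axis i 1)" d 0 \<epsilon>] assms(1)
    by (auto simp: has_partial_def dist_real_def)
qed

text \<open>A frame on the set where the bump function b does not vanish.  The functionals
  v \<mapsto> b(q) v(\<xi>_i) - \<xi>_i(q) v(b) are dual to it up to the factor b(q)^3; with \<xi>_i = b y_i for
  coordinates y_i, they are b(q)^2 times the i-th component of v.\<close>

locale cut_off_frame = smooth_manifold A
  for A :: "('a::{t2_space,second_countable_topology} set \<times> ('a \<Rightarrow> real^'n::finite)) set" +
  fixes b :: "'a \<Rightarrow> real" and \<xi> :: "'n \<Rightarrow> 'a \<Rightarrow> real"
    and E :: "'n \<Rightarrow> ('a \<Rightarrow> real) \<Rightarrow> 'a \<Rightarrow> real"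
  assumes smooth_b: "smooth b"
    and smooth_\<xi>: "smooth (\<xi> i)"
    and E_in_VF: "E i \<in> VF"
    and frame_expansion: "v \<in> T q \<Longrightarrow> smooth f \<Longrightarrow>
       b q ^ 3 * v f = (\<Sum>i\<in>UNIV. (b q * v (\<xi> i) - \<xi> i q * v b) * E i f q)"
    and frame_dual: "b q * E i (\<xi> j) q - \<xi> j q * E i b q = (if i = j then b q ^ 3 else 0)"
    and frame_minimum: "smooth f \<Longrightarrow> f q = 0 \<Longrightarrow> (\<And>x. 0 \<le> f x) \<Longrightarrow> E i f q = 0"

text \<open>In a chart, b is the flat function of (R/2)^2 - |y - c|^2. It vanishes outside the
  closed ball K of radius R/2, a compact subset of the open ball S of radius R, so everything
  multiplied by it extends by zero. The frame fields are the coordinate derivations times b.\<close>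

lemma (in smooth_manifold) local_frame:
  obtains b \<xi> E where "cut_off_frame A b \<xi> E" "b p \<noteq> 0"
proof -
  obtain U \<phi> where U: "(U, \<phi>) \<in> A" "p \<in> U" by (rule chart_exists)
  let ?inv = "inv_into U \<phi>"
  define c where "c = \<phi> p"
  obtain R where R: "R > 0" "ball c R \<subseteq> \<phi> ` U"
    using chart_open_image[OF U(1)] U(2) unfolding open_contains_ball c_def by blast
  define S where "S = ball c R"
  define K where "K = cball c (R / 2)"
  have S: "open S" "S \<subseteq> \<phi> ` U" "convex S" "c \<in> S" and K: "compact K" "K \<subseteq> S"
    using R by (auto simp: S_def K_def)
  define s where "s y = (R/2)\<^sup>2 - (\<Sum>i\<in>UNIV. (y $ i + - (c $ i)) * (y $ i + - (c $ i)))" for y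
  have s_eq: "s y = (R/2)\<^sup>2 - (dist c y)\<^sup>2" for y
    unfolding s_def dist_norm power2_norm_eq_inner inner_vec_def by (simp add: algebra_simps)
  define B where "B y = flat_exp 0 (s y)" for y
  have B_smooth: "smooth_on W B" if "open W" for W
  proof -
    have "smooth_on W (\<lambda>y. (R/2)\<^sup>2 + (-1) * (\<Sum>i\<in>UNIV. (y $ i + - (c $ i)) * (y $ i + - (c $ i))))"
      by (intro smooth_on_add smooth_on_mult smooth_on_sum smooth_on_const smooth_on_coord that)
    then have "smooth_on W s" by (simp add: s_def[abs_def])
    then show ?thesis unfolding B_def[abs_def] by (rule smooth_on_flat_exp[OF that])
  qed
  have B_zero: "B y = 0" if "y \<notin> K" for y
  proof -
    have "(R/2)\<^sup>2 < (dist c y)\<^sup>2"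
      using that R(1) by (intro power_strict_mono) (auto simp: K_def)
    then show ?thesis by (simp add: B_def s_eq flat_exp_def)
  qed
  have B_c: "B c \<noteq> 0" using R(1) by (simp add: B_def s_eq flat_exp_def)
  let ?ext = "extend_by_zero U \<phi> S"
  have ext_smooth: "smooth (?ext (\<lambda>y. B y * F y))" if "smooth_on S F" for F
    by (rule smooth_extend_by_zero[OF U(1) S(1,2) _ K])
      (use that B_zero in \<open>auto intro: smooth_on_mult S(1) B_smooth\<close>)
  have ext_inside: "?ext F q = F (\<phi> q)" if "q \<in> U" "\<phi> q \<in> S" for F q
    using that by (simp add: extend_by_zero_def)
  have ext_outside: "?ext F q = 0" if "\<not> (q \<in> U \<and> \<phi> q \<in> S)" for F q
    using that by (auto simp: extend_by_zero_def)
  have inv_\<phi>: "?inv (\<phi> q) = q" if "q \<in> U" for q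
    using that chart_inj[OF U(1)] by simp
  have \<phi>_inv: "\<phi> (?inv y) = y" and inv_in: "?inv y \<in> U" if "y \<in> S" for y
    using that S(2) by (auto simp: f_inv_into_f inv_into_into)
  have loc_smooth: "smooth_on S (\<lambda>y. f (?inv y))" if "smooth f" for f
    by (rule smooth_on_subset[OF _ S(2)]) (use that U(1) in \<open>simp add: smooth_fun_iff\<close>)
  define \<delta> where "\<delta> f i = partial (\<lambda>y. f (?inv y)) i" for f i
  have \<delta>: "has_partial (\<lambda>y. f (?inv y)) i (\<delta> f i y) y" if "smooth f" "y \<in> S" for f i y
    unfolding \<delta>_def using has_partial_partial[OF loc_smooth[OF that(1)] S(1) that(2)] .
  define b where "b = ?ext (\<lambda>y. B y)"
  define \<xi> where "\<xi> i = ?ext (\<lambda>y. B y * y $ i)" for i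
  \<comment> \<open>The case distinction meets the convention that derivations vanish on non-smooth
    functions.\<close>
  define E where "E i f = (if smooth f then ?ext (\<lambda>y. B y * \<delta> f i y) else (\<lambda>q. 0))" for i f
  have b: "smooth b" unfolding b_def using ext_smooth[OF smooth_on_const[of S 1]] by simp
  have \<xi>: "smooth (\<xi> i)" for i unfolding \<xi>_def by (rule ext_smooth) simp
  have E_smooth: "smooth (E i f)" if "smooth f" for i f
    using that ext_smooth[OF smooth_on_partial_deriv[OF loc_smooth[OF that] S(1)]]
    by (simp add: E_def \<delta>_def)
  have E_inside: "E i f q = B (\<phi> q) * \<delta> f i (\<phi> q)" if "smooth f" "q \<in> U" "\<phi> q \<in> S" for i f q
    using that by (simp add: E_def ext_inside)
  have E_outside: "E i f q = 0" if "\<not> (q \<in> U \<and> \<phi> q \<in> S)" for i f q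
    using that by (simp add: E_def ext_outside)
  have \<delta>_add: "\<delta> (\<lambda>q. f q + h q) i y = \<delta> f i y + \<delta> h i y"
    and \<delta>_mult: "\<delta> (\<lambda>q. f q * h q) i y = \<delta> f i y * h (?inv y) + \<delta> h i y * f (?inv y)"
    if "smooth f" "smooth h" "y \<in> S" for f h i y
    using partial_eq[OF has_partial_add[OF \<delta>[OF that(1,3)] \<delta>[OF that(2,3)]]]
      partial_eq[OF has_partial_mult[OF \<delta>[OF that(1,3)] \<delta>[OF that(2,3)]]]
    by (simp_all add: \<delta>_def)
  have \<delta>_const: "\<delta> (\<lambda>q. k) i y = 0" for k i y
    unfolding \<delta>_def by (rule partial_eq[OF has_partial_const])
  have E_VF: "E i \<in> VF" for i
    unfolding vector_fields_iff
  proof (intro conjI allI impI E_smooth)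
    fix q
    show "at_pt (E i) q \<in> T q"
    proof (cases "q \<in> U \<and> \<phi> q \<in> S")
      case True
      then show ?thesis
        unfolding tangent_space_def at_pt_def mem_Collect_eq
        using \<delta>_mult[OF smooth_const]
        by (auto simp: E_inside smooth_intros \<delta>_add \<delta>_mult \<delta>_const inv_\<phi> algebra_simps)
          (simp add: E_def)
    next
      case False
      then have "at_pt (E i) q = (\<lambda>f. 0)" by (simp add: at_pt_def E_outside fun_eq_iff)
      then show ?thesis by (simp add: tangent_space_zero)
    qed
  qed
  have "cut_off_frame A b \<xi> E"
  proof (unfold_locales, fact b, fact \<xi>, fact E_VF)
    fix q v f assume v: "v \<in> T q" and f: "smooth f"
    show "b q ^ 3 * v f = (\<Sum>i\<in>UNIV. (b q * v (\<xi> i) - \<xi> i q * v b) * E i f q)"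
    proof (cases "q \<in> U \<and> \<phi> q \<in> S")
      case True
      define y0 where "y0 = \<phi> q"
      have q: "y0 \<in> S" "?inv y0 = q" using True by (auto simp: y0_def inv_\<phi>)
      obtain h where h: "\<And>i. smooth_on S (h i)"
        "\<And>y. y \<in> S \<Longrightarrow> f (?inv y) = f (?inv y0) + (\<Sum>i\<in>UNIV. (y $ i - y0 $ i) * h i y)"
        "\<And>i. has_partial (\<lambda>y. f (?inv y)) i (h i y0) y0"
        by (rule hadamard[OF loc_smooth[OF f] S(1,3) q(1)]) blast
      define \<eta> where "\<eta> i = ?ext (\<lambda>y. B y * h i y)" for i
      have \<eta>: "smooth (\<eta> i)" for i unfolding \<eta>_def by (rule ext_smooth[OF h(1)])
      have \<eta>_q: "\<eta> i q = b q * \<delta> f i y0" for i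
        using True partial_eq[OF h(3)] by (simp add: \<eta>_def b_def ext_inside y0_def \<delta>_def)
      \<comment> \<open>Hadamard's expansion times b^2: one factor b goes to the coordinate
        difference, the other to the coefficient function. All functions involved are now global,
        and outside the chart ball both sides vanish.\<close>
      have eq: "b q' * (b q' * (f q' + - f q)) = (\<Sum>i\<in>UNIV. (\<xi> i q' + (- (y0 $ i)) * b q') * \<eta> i q')" for q'
      proof (cases "q' \<in> U \<and> \<phi> q' \<in> S")
        case True
        then have "f q' + - f q = (\<Sum>i\<in>UNIV. (\<phi> q' $ i - y0 $ i) * h i (\<phi> q'))"
          using h(2)[of "\<phi> q'"] by (simp add: inv_\<phi> q)
        then show ?thesis
          using True by (simp add: b_def \<xi>_def \<eta>_def ext_inside sum_distrib_left algebra_simps)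
      qed (simp add: b_def \<xi>_def \<eta>_def ext_outside)
      \<comment> \<open>The difference f - f(q) vanishes at q, so the product rule applied twice
        leaves only this term.\<close>
      have "b q * (b q * v f) = v (\<lambda>q'. b q' * (b q' * (f q' + - f q)))"
        using tangent_add[OF v f smooth_const, of "- f q"] tangent_const[OF v, of "- f q"]
        by (simp add: tangent_mult[OF v] smooth_mult smooth_diff b f)
      also have "\<dots> = v (\<lambda>q'. \<Sum>i\<in>UNIV. (\<xi> i q' + (- (y0 $ i)) * b q') * \<eta> i q')"
        by (simp only: eq)
      also have "\<dots> = (\<Sum>i\<in>UNIV. v (\<lambda>q'. (\<xi> i q' + (- (y0 $ i)) * b q') * \<eta> i q'))"
        by (intro tangent_sum[OF v] smooth_mult smooth_add smooth_const \<xi> b \<eta>)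
      also have "\<dots> = (\<Sum>i\<in>UNIV. \<eta> i q * (v (\<xi> i) - y0 $ i * v b))"
      proof (intro sum.cong refl)
        fix i
        have "\<xi> i q + (- (y0 $ i)) * b q = 0"
          using True by (simp add: \<xi>_def b_def ext_inside y0_def)
        moreover have "v (\<lambda>q'. \<xi> i q' + (- (y0 $ i)) * b q') = v (\<xi> i) + (- (y0 $ i)) * v b"
          by (simp only: tangent_add[OF v \<xi> smooth_mult[OF smooth_const b]] tangent_scale[OF v b])
        ultimately show "v (\<lambda>q'. (\<xi> i q' + (- (y0 $ i)) * b q') * \<eta> i q') = \<eta> i q * (v (\<xi> i) - y0 $ i * v b)"
          using tangent_mult[OF v smooth_add[OF \<xi> smooth_mult[OF smooth_const b]] \<eta>,
              of i "- (y0 $ i)" i] by simp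
      qed
      \<comment> \<open>The third factor b q turns y0_i into \<xi>_i(q) in the coefficients.\<close>
      finally have "b q ^ 3 * v f = b q * (\<Sum>i\<in>UNIV. \<eta> i q * (v (\<xi> i) - y0 $ i * v b))"
        by (simp add: power3_eq_cube)
      also have "\<dots> = (\<Sum>i\<in>UNIV. (b q * v (\<xi> i) - \<xi> i q * v b) * E i f q)"
        unfolding sum_distrib_left
        by (rule sum.cong)
          (use True in \<open>simp_all add: \<eta>_q E_inside[OF f] \<xi>_def b_def ext_inside y0_def algebra_simps\<close>)
      finally show ?thesis .
    qed (simp add: b_def E_outside ext_outside)
  next
    fix q i j
    show "b q * E i (\<xi> j) q - \<xi> j q * E i b q = (if i = j then b q ^ 3 else 0)"
    proof (cases "q \<in> U \<and> \<phi> q \<in> S")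
      case True
      then have q: "\<phi> q \<in> S" by simp
      have part: "has_partial B i (partial B i (\<phi> q)) (\<phi> q)"
        using has_partial_partial[OF B_smooth[OF S(1)] S(1) q] .
      have "\<delta> b i (\<phi> q) = partial B i (\<phi> q)"
        unfolding \<delta>_def
        by (rule partial_eq, subst has_partial_cong[OF S(1) q, of _ B])
          (use part in \<open>simp_all add: b_def ext_inside inv_in \<phi>_inv\<close>)
      moreover have "\<delta> (\<xi> j) i (\<phi> q)
          = partial B i (\<phi> q) * \<phi> q $ j + (if i = j then 1 else 0) * B (\<phi> q)"
        unfolding \<delta>_def
        by (rule partial_eq, subst has_partial_cong[OF S(1) q, of _ "\<lambda>y. B y * y $ j"])
          (use has_partial_mult[OF part has_partial_coord] in
            \<open>simp_all add: \<xi>_def ext_inside inv_in \<phi>_inv\<close>)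
      \<comment> \<open>The terms with a derivative of the bump function cancel; what remains is B^3
        on the diagonal.\<close>
      ultimately show ?thesis
        using True
        by (simp add: E_inside b \<xi>, simp add: b_def \<xi>_def ext_inside power3_eq_cube algebra_simps)
    qed (simp add: b_def \<xi>_def E_outside ext_outside)
  next
    fix q i f assume f: "smooth f" "f q = 0" "\<And>x. 0 \<le> f x"
    show "E i f q = 0"
    proof (cases "q \<in> U \<and> \<phi> q \<in> S")
      case True
      have "\<delta> f i (\<phi> q) = 0"
        by (rule has_partial_at_minimum[OF \<delta>[OF f(1)] S(1)]) (use True f in \<open>auto simp: inv_\<phi>\<close>)
      then show ?thesis using True by (simp add: E_inside f)
    qed (simp add: E_outside)
  qed
  moreover have "b p \<noteq> 0" using U(2) S(4) B_c by (simp add: b_def ext_inside c_def)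
  ultimately show ?thesis by (rule that)
qed

subsection \<open>One-forms and the metric dual\<close>

abbreviation (input) field_comb ::
  "('a \<Rightarrow> real) \<Rightarrow> (('a \<Rightarrow> real) \<Rightarrow> 'a \<Rightarrow> real) \<Rightarrow> (('a \<Rightarrow> real) \<Rightarrow> 'a \<Rightarrow> real) \<Rightarrow> ('a \<Rightarrow> real) \<Rightarrow> 'a \<Rightarrow> real" where
  "field_comb f Z W \<equiv> \<lambda>h q. f q * Z h q + W h q"

context smooth_manifold
begin

text \<open>The coefficients of v in the frame at p are kept constant over the manifold. This links
  representatives and one-forms, which are tested on fields, with nondegeneracy, which is tested on
  single tangent vectors.\<close>

lemma tangent_extend:
  assumes "v \<in> T p"
  shows "\<exists>X\<in>VF. at_pt X p = v"
proof -
  obtain b \<xi> E where "cut_off_frame A b \<xi> E" and bp: "b p \<noteq> 0" by (rule local_frame)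
  then interpret cut_off_frame A b \<xi> E by simp
  define a where "a i = (b p * v (\<xi> i) - \<xi> i p * v b) / b p ^ 3" for i
  define X where "X h q = (\<Sum>i\<in>UNIV. a i * E i h q)" for h q
  have "X \<in> VF"
    unfolding X_def[abs_def] by (rule vector_fields_sum) (simp_all add: E_in_VF)
  moreover have "X h p = v h" for h
  proof (cases "smooth h")
    case True
    then have "b p ^ 3 * v h = b p ^ 3 * X h p"
      using frame_expansion[OF assms True] bp by (simp add: X_def a_def sum_distrib_left)
    then show ?thesis using bp by simp
  next
    case False
    then show ?thesis
      using VF_nonsmooth[OF E_in_VF] tangent_nonsmooth[OF assms] by (simp add: X_def)
  qed
  ultimately show ?thesis by (intro bexI[of _ X]) (auto simp: at_pt_def)
qed

lemma
  assumes "smooth_one_form A \<omega>"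
  shows one_form_smooth: "Z \<in> VF \<Longrightarrow> smooth (\<omega> Z)"
    and one_form_comb: "Z \<in> VF \<Longrightarrow> W \<in> VF \<Longrightarrow> smooth f \<Longrightarrow>
      \<omega> (field_comb f Z W) = (\<lambda>q. f q * \<omega> Z q + \<omega> W q)"
  using assms unfolding smooth_one_form_def by blast+

lemma one_form_zero:
  assumes "smooth_one_form A \<omega>"
  shows "\<omega> (\<lambda>h q. 0) = (\<lambda>q. 0)"
  using one_form_comb[OF assms vector_fields_zero vector_fields_zero smooth_const, of 1]
  by (simp add: fun_eq_iff)

lemma one_form_sum:
  assumes \<omega>: "smooth_one_form A \<omega>" and "\<And>i. i \<in> I \<Longrightarrow> smooth (f i)" "\<And>i. i \<in> I \<Longrightarrow> Z i \<in> VF"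
  shows "\<omega> (\<lambda>h q. \<Sum>i\<in>I. f i q * Z i h q) = (\<lambda>q. \<Sum>i\<in>I. f i q * \<omega> (Z i) q)"
  using assms(2,3)
proof (induction I rule: infinite_finite_induct)
  case (insert i I)
  then have "(\<lambda>h q. \<Sum>i\<in>I. f i q * Z i h q) \<in> VF" by (intro vector_fields_sum) auto
  with one_form_comb[OF \<omega>, of "Z i" "\<lambda>h q. \<Sum>i\<in>I. f i q * Z i h q" "f i"] insert
  show ?case by simp
qed (simp_all add: one_form_zero[OF \<omega>])

end

context cut_off_frame
begin

text \<open>Linearity of \<omega> is available only for fields with globally smooth coefficients, so
  the frame expansion is first read as an identity between fields, with \<open>b ^ 3\<close>
  undivided. The outcome is that \<omega> is determined pointwise by its values on the
  frame.\<close>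

lemma one_form_expansion:
  assumes \<omega>: "smooth_one_form A \<omega>" and Z: "Z \<in> VF"
  shows "b q ^ 3 * \<omega> Z q = (\<Sum>i\<in>UNIV. (b q * Z (\<xi> i) q - \<xi> i q * Z b q) * \<omega> (E i) q)"
proof -
  define a where "a i q = b q * Z (\<xi> i) q - \<xi> i q * Z b q" for i q
  have a: "smooth (a i)" for i
    unfolding a_def[abs_def]
    by (intro smooth_diff smooth_mult smooth_b smooth_\<xi> smooth_VF[OF Z smooth_b] smooth_VF[OF Z smooth_\<xi>])
  have b3: "smooth (\<lambda>q. b q ^ 3)"
    unfolding power3_eq_cube by (intro smooth_mult smooth_b)
  have "field_comb (\<lambda>q. b q ^ 3) Z (\<lambda>h q. 0) = (\<lambda>h q. \<Sum>i\<in>UNIV. a i q * E i h q)"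
  proof (intro ext)
    fix h q
    show "b q ^ 3 * Z h q + 0 = (\<Sum>i\<in>UNIV. a i q * E i h q)"
    proof (cases "smooth h")
      case True
      then show ?thesis
        using frame_expansion[OF at_pt_in_T[OF Z] True, of q] by (simp add: a_def at_pt_def)
    next
      case False
      then show ?thesis using VF_nonsmooth[OF E_in_VF] VF_nonsmooth[OF Z] by simp
    qed
  qed
  then have "(\<lambda>q. b q ^ 3 * \<omega> Z q) = (\<lambda>q. \<Sum>i\<in>UNIV. a i q * \<omega> (E i) q)"
    using one_form_comb[OF \<omega> Z vector_fields_zero b3] one_form_zero[OF \<omega>]
      one_form_sum[OF \<omega>, of UNIV a E] a E_in_VF by simp
  then show ?thesis by (simp add: a_def fun_eq_iff)
qed

lemma tangent_expansion:
  assumes "v \<in> T q" "b q \<noteq> 0"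
  shows "v = (\<lambda>f. \<Sum>i\<in>UNIV. ((b q * v (\<xi> i) - \<xi> i q * v b) / b q ^ 3) * at_pt (E i) q f)"
proof
  fix f
  show "v f = (\<Sum>i\<in>UNIV. ((b q * v (\<xi> i) - \<xi> i q * v b) / b q ^ 3) * at_pt (E i) q f)"
  proof (cases "smooth f")
    case True
    have "b q ^ 3 * v f
        = b q ^ 3 * (\<Sum>i\<in>UNIV. ((b q * v (\<xi> i) - \<xi> i q * v b) / b q ^ 3) * at_pt (E i) q f)"
      using frame_expansion[OF assms(1) True] assms(2) by (simp add: at_pt_def sum_distrib_left)
    then show ?thesis using assms(2) by simp
  next
    case False
    then show ?thesis
      using VF_nonsmooth[OF E_in_VF] tangent_nonsmooth[OF assms(1)] by (simp add: at_pt_def)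
  qed
qed

end

section \<open>Symmetric bilinear metrics, possibly degenerate, and the inner product of flat
  forms\<close>

locale metric_manifold = smooth_manifold A
  for A :: "('a::{t2_space,second_countable_topology} set \<times> ('a \<Rightarrow> real^'n::finite)) set" +
  fixes g :: "'a bilin"
  assumes metric: "sym_bilinear_metric A g"
begin

lemma
  assumes "v \<in> T p" "w \<in> T p"
  shows metric_sym: "g p v w = g p w v"
    and metric_scale_left: "g p (\<lambda>f. c * v f) w = c * g p v w"
    and metric_add_left: "u \<in> T p \<Longrightarrow> g p (\<lambda>f. v f + u f) w = g p v w + g p u w"
  using assms metric unfolding sym_bilinear_metric_def by blast+

lemma metric_comb_left:
  assumes "u \<in> T p" "v \<in> T p" "w \<in> T p"
  shows "g p (\<lambda>f. c * u f + v f) w = c * g p u w + g p v w"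
  using assms by (simp add: metric_add_left metric_scale_left tangent_space_scale)

lemma metric_zero_left: "w \<in> T p \<Longrightarrow> g p (\<lambda>f. 0) w = 0"
  using metric_scale_left[OF tangent_space_zero, of w p 0] by simp

lemma metric_sum_left:
  assumes "\<And>i. i \<in> I \<Longrightarrow> v i \<in> T p" "w \<in> T p"
  shows "g p (\<lambda>f. \<Sum>i\<in>I. c i * v i f) w = (\<Sum>i\<in>I. c i * g p (v i) w)"
  using assms
  by (induction I rule: infinite_finite_induct)
    (simp_all add: metric_zero_left metric_comb_left tangent_space_sum)

lemma metric_eq_if_eq_on_fields:
  assumes "u \<in> T p" "u' \<in> T p" "w \<in> T p"
    and "\<And>Z. Z \<in> VF \<Longrightarrow> g p u (at_pt Z p) = g p u' (at_pt Z p)"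
  shows "g p u w = g p u' w"
proof -
  obtain X where "X \<in> VF" "at_pt X p = w" using tangent_extend[OF assms(3)] by blast
  then show ?thesis using assms(4)[of X] by simp
qed

lemma gfun_smooth: "X \<in> VF \<Longrightarrow> Y \<in> VF \<Longrightarrow> smooth (gfun g X Y)"
  using metric unfolding sym_bilinear_metric_def by blast

lemma gfun_sym: "X \<in> VF \<Longrightarrow> Y \<in> VF \<Longrightarrow> gfun g X Y p = gfun g Y X p"
  by (simp add: gfun_def metric_sym at_pt_in_T)

lemma gfun_comb_left:
  assumes "Z \<in> VF" "W \<in> VF" "Y \<in> VF"
  shows "gfun g (field_comb f Z W) Y p = f p * gfun g Z Y p + gfun g W Y p"
  using metric_comb_left[OF assms[THEN at_pt_in_T], of p "f p"] by (simp add: gfun_def at_pt_def)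

lemma gfun_comb_right:
  assumes "Z \<in> VF" "W \<in> VF" "Y \<in> VF" "smooth f"
  shows "gfun g Y (field_comb f Z W) p = f p * gfun g Y Z p + gfun g Y W p"
  using gfun_comb_left[OF assms(1-3), of f p] assms
  by (simp add: gfun_sym[of Y] vector_fields_module_op)

text \<open>Well-definedness of the inner product on flat forms. Two representatives of one form
  have equal products with every tangent vector, so the two chosen representatives are replaced one
  after the other, with symmetry in between.\<close>

lemma inner_bullet_eq:
  assumes u: "flat_rep A g \<alpha> p u" and v: "flat_rep A g \<beta> p v"
  shows "inner_bullet A g p \<alpha> \<beta> = g p u v"
proof -
  have eq: "g p u1 w = g p u2 w" if "flat_rep A g \<gamma> p u1" "flat_rep A g \<gamma> p u2" "w \<in> T p" for \<gamma> u1 u2 w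
    by (rule metric_eq_if_eq_on_fields) (use that in \<open>auto simp: flat_rep_def\<close>)
  define u' v' where "u' = (SOME u. flat_rep A g \<alpha> p u)" and "v' = (SOME v. flat_rep A g \<beta> p v)"
  have u': "flat_rep A g \<alpha> p u'" and v': "flat_rep A g \<beta> p v'"
    unfolding u'_def v'_def
    using someI[of "flat_rep A g \<alpha> p", OF u] someI[of "flat_rep A g \<beta> p", OF v] by auto
  have T: "u \<in> T p" "v \<in> T p" "u' \<in> T p" "v' \<in> T p"
    using u v u' v' by (auto simp: flat_rep_def)
  have "g p u' v' = g p u v'" by (rule eq[OF u' u T(4)])
  also have "\<dots> = g p v' u" by (rule metric_sym[OF T(1,4)])
  also have "\<dots> = g p v u" by (rule eq[OF v' v T(1)])
  also have "\<dots> = g p u v" by (rule metric_sym[OF T(2,1)])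
  finally show ?thesis by (simp add: inner_bullet_def u'_def v'_def)
qed

end

section \<open>Dual vector fields for a nondegenerate metric\<close>

locale semi_riemannian_manifold = metric_manifold A g
  for A :: "('a::{t2_space,second_countable_topology} set \<times> ('a \<Rightarrow> real^'n::finite)) set" and g +
  assumes nondeg: "nondegenerate A g"
begin

lemma tangent_eq_if_metric_eq:
  assumes "u \<in> T p" "v \<in> T p" and eq: "\<And>Z. Z \<in> VF \<Longrightarrow> g p u (at_pt Z p) = g p v (at_pt Z p)"
  shows "u = v"
proof -
  define w where "w = (\<lambda>f. (- 1) * u f + v f)"
  have w: "w \<in> T p"
    unfolding w_def by (intro tangent_space_add tangent_space_scale assms)
  have "g p w z = 0" if "z \<in> T p" for z
    using metric_eq_if_eq_on_fields[OF assms(1,2) that eq] metric_comb_left[OF assms(1,2) that, of "- 1"]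
    by (simp add: w_def)
  with w nondeg have "w = (\<lambda>f. 0)" unfolding nondegenerate_def by blast
  then show ?thesis by (simp add: w_def fun_eq_iff)
qed

text \<open>The dual vector at a point is unique, so V is defined by choice at each point and
  coincides with every local solution. Locally the linear system for the frame coefficients is
  solved by Cramer's rule, with smooth numerators and denominator.\<close>

lemma metric_dual_exists:
  assumes \<omega>: "smooth_one_form A \<omega>"
  shows "\<exists>V\<in>VF. \<forall>Z\<in>VF. gfun g V Z = \<omega> Z"
proof -
  define dual where "dual q v \<longleftrightarrow> v \<in> T q \<and> (\<forall>Z\<in>VF. g q v (at_pt Z q) = \<omega> Z q)" for q v
  define V where "V f q = (SOME v. dual q v) f" for f q
  have V_eq: "V f q = v f" if "dual q v" for f q v
  proof -
    have "dual q (SOME v. dual q v)" using someI[of "dual q", OF that] .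
    then have "(SOME v. dual q v) = v"
      using that by (intro tangent_eq_if_metric_eq[of _ q]) (auto simp: dual_def)
    then show ?thesis by (simp add: V_def)
  qed
  have local: "\<exists>d (n :: 'n \<Rightarrow> 'a \<Rightarrow> real) E. smooth d \<and> d p \<noteq> 0 \<and> (\<forall>i. smooth (n i) \<and> E i \<in> VF) \<and>
      (\<forall>q. d q \<noteq> 0 \<longrightarrow> dual q (\<lambda>f. \<Sum>i\<in>UNIV. (n i q / d q) * at_pt (E i) q f))" for p
  proof -
    obtain b \<xi> E where "cut_off_frame A b \<xi> E" and bp: "b p \<noteq> 0" by (rule local_frame)
    then interpret cut_off_frame A b \<xi> E by simp
    note E_T = at_pt_in_T[OF E_in_VF]
    define M where "M q = (\<chi> i j. gfun g (E j) (E i) q)" for q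
    \<comment> \<open>Cramer's numerator: column k of the Gram matrix M is replaced by the values of
      \<omega> on the frame.\<close>
    define N where "N k q = det (\<chi> i j. if j = k then \<omega> (E i) q else M q $ i $ j)" for k q
    have M_smooth: "smooth (\<lambda>q. det (M q))"
      by (rule smooth_det) (simp add: M_def gfun_smooth E_in_VF)
    have N_smooth: "smooth (N k)" for k
      unfolding N_def[abs_def]
    proof (rule smooth_det)
      fix i j
      show "smooth (\<lambda>q. (\<chi> i j. if j = k then \<omega> (E i) q else M q $ i $ j) $ i $ j)"
        using one_form_smooth[OF \<omega> E_in_VF, of i] gfun_smooth[OF E_in_VF E_in_VF]
        by (cases "j = k") (simp_all add: M_def)
    qed
    \<comment> \<open>A kernel vector c of M gives a combination v of the frame that is orthogonal
      to the frame, hence to every tangent vector, hence zero; the dual functionals then return c_j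
      b^3 = 0.\<close>
    have det_nz: "det (M q) \<noteq> 0" if bq: "b q \<noteq> 0" for q
    proof -
      have "c = 0" if c: "M q *v c = 0" for c
      proof -
        define v where "v = (\<lambda>f. \<Sum>j\<in>UNIV. c $ j * at_pt (E j) q f)"
        have v: "v \<in> T q" unfolding v_def by (rule tangent_space_sum) (rule E_T)
        have vE: "g q v (at_pt (E i) q) = 0" for i
        proof -
          have "g q v (at_pt (E i) q) = (M q *v c) $ i"
            unfolding v_def
            by (subst metric_sum_left)
              (simp_all add: E_T M_def gfun_def matrix_vector_mult_def mult.commute)
          then show ?thesis using c by simp
        qed
        have "g q v w = 0" if w: "w \<in> T q" for w
        proof -
          have "g q v w = g q w v" by (rule metric_sym[OF v w])
          also have "\<dots> = 0"
            using vE metric_sym[OF v E_T]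
            by (subst tangent_expansion[OF w bq], subst metric_sum_left) (simp_all add: E_T v)
          finally show ?thesis .
        qed
        then have v0: "v = (\<lambda>f. 0)"
          using v nondeg unfolding nondegenerate_def by blast
        have "c $ j = 0" for j
        proof -
          have "0 = b q * v (\<xi> j) - \<xi> j q * v b" by (simp add: v0)
          also have "\<dots> = (\<Sum>i\<in>UNIV. c $ i * (b q * E i (\<xi> j) q - \<xi> j q * E i b q))"
            by (simp add: v_def at_pt_def sum_distrib_left sum_subtractf[symmetric] algebra_simps)
          also have "\<dots> = (\<Sum>i\<in>UNIV. if i = j then c $ i * b q ^ 3 else 0)"
            by (rule sum.cong) (auto simp: frame_dual)
          also have "\<dots> = c $ j * b q ^ 3" by simp
          finally show ?thesis using bq by simp
        qed
        then show ?thesis by (simp add: vec_eq_iff)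
      qed
      then show ?thesis
        using matrix_left_invertible_ker invertible_left_inverse invertible_det_nz by metis
    qed
    show ?thesis
    \<comment> \<open>The factor b makes the denominator vanish wherever the frame degenerates, so d
      q nonzero yields both a frame and an invertible M; it cancels in the quotient.\<close>
    proof (intro exI[of _ "\<lambda>q. b q * det (M q)"] exI[of _ "\<lambda>i q. b q * N i q"] exI[of _ E]
        conjI allI impI)
      show "smooth (\<lambda>q. b q * det (M q))" by (intro smooth_mult smooth_b M_smooth)
      show "smooth (\<lambda>q. b q * N i q)" for i by (intro smooth_mult smooth_b N_smooth)
      show "b p * det (M p) \<noteq> 0" using bp det_nz by simp
    next
      fix q assume "b q * det (M q) \<noteq> 0"
      then have bq: "b q \<noteq> 0" and dq: "det (M q) \<noteq> 0" by auto
      define x where "x = (\<chi> k. N k q / det (M q))"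
      have x: "M q *v x = (\<chi> i. \<omega> (E i) q)"
        unfolding cramer[OF dq] x_def N_def by (simp cong: if_cong)
      define v where "v = (\<lambda>f. \<Sum>i\<in>UNIV. (x $ i) * at_pt (E i) q f)"
      have v: "v \<in> T q" unfolding v_def by (rule tangent_space_sum) (rule E_T)
      have vE: "g q v (at_pt (E i) q) = \<omega> (E i) q" for i
      proof -
        have "g q v (at_pt (E i) q) = (M q *v x) $ i"
          unfolding v_def
          by (subst metric_sum_left)
            (simp_all add: E_T M_def gfun_def matrix_vector_mult_def mult.commute)
        then show ?thesis by (simp add: x)
      qed
      have "g q v (at_pt Z q) = \<omega> Z q" if Z: "Z \<in> VF" for Z
      proof -
        let ?Z = "at_pt Z q"
        have ZT: "?Z \<in> T q" by (rule at_pt_in_T[OF Z])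
        have "g q v ?Z = g q ?Z v" by (rule metric_sym[OF v ZT])
        also have "\<dots> = (\<Sum>i\<in>UNIV. ((b q * ?Z (\<xi> i) - \<xi> i q * ?Z b) / b q ^ 3) * g q (at_pt (E i) q) v)"
          by (subst tangent_expansion[OF ZT bq], rule metric_sum_left) (simp_all add: E_T v)
        also have "\<dots> = (\<Sum>i\<in>UNIV. ((b q * Z (\<xi> i) q - \<xi> i q * Z b q) * \<omega> (E i) q) / b q ^ 3)"
          using metric_sym[OF v E_T] vE by (simp add: at_pt_def)
        also have "\<dots> = \<omega> Z q"
          using one_form_expansion[OF \<omega> Z, of q] bq by (simp add: sum_divide_distrib[symmetric] field_simps)
        finally show ?thesis .
      qed
      with v have "dual q v" by (simp add: dual_def)
      moreover have "v = (\<lambda>f. \<Sum>i\<in>UNIV. (b q * N i q / (b q * det (M q))) * at_pt (E i) q f)"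
        using bq by (simp add: v_def x_def)
      ultimately show "dual q (\<lambda>f. \<Sum>i\<in>UNIV. (b q * N i q / (b q * det (M q))) * at_pt (E i) q f)"
        by simp
    qed (rule E_in_VF)
  qed
  have V_dual: "dual q (at_pt V q)" for q
  proof -
    from local[of q] obtain v where "dual q v" by blast
    then show ?thesis using V_eq by (simp add: at_pt_def)
  qed
  have "V \<in> VF"
    unfolding vector_fields_iff
  proof (intro conjI allI impI)
    show "at_pt V q \<in> T q" for q using V_dual by (simp add: dual_def)
    fix f assume f: "smooth f"
    show "smooth (V f)"
    proof (rule smooth_if_local_quotient)
      fix p
      from local[of p] obtain d and n :: "'n \<Rightarrow> 'a \<Rightarrow> real" and E where
        d: "smooth d" "d p \<noteq> 0" and n: "\<And>i. smooth (n i)" and E: "\<And>i. E i \<in> VF" and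
        v: "\<And>q. d q \<noteq> 0 \<Longrightarrow> dual q (\<lambda>f. \<Sum>i\<in>UNIV. (n i q / d q) * at_pt (E i) q f)"
        by blast
      show "\<exists>d u. smooth d \<and> smooth u \<and> d p \<noteq> 0 \<and> (\<forall>q. d q \<noteq> 0 \<longrightarrow> d q * V f q = u q)"
      proof (rule exI[of _ d], rule exI[of _ "\<lambda>q. \<Sum>i\<in>UNIV. n i q * E i f q"],
          intro conjI d allI impI)
        show "smooth (\<lambda>q. \<Sum>i\<in>UNIV. n i q * E i f q)"
          by (intro smooth_sum smooth_mult n smooth_VF[OF E f])
        show "d q * V f q = (\<Sum>i\<in>UNIV. n i q * E i f q)" if "d q \<noteq> 0" for q
          using that by (simp add: V_eq[OF v[OF that]] at_pt_def sum_distrib_left)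
      qed
    qed
  qed
  then show ?thesis
    using V_dual by (intro bexI[of _ V]) (auto simp: dual_def gfun_def)
qed

end

subsection \<open>The Koszul form\<close>

context metric_manifold
begin

text \<open>The Leibniz rule of the bracket, stated with nested \<open>field_comb\<close> so that
  the linearity rules for the metric rewrite it directly.\<close>

lemma lie_bracket_comb_right:
  assumes "X \<in> VF" "Z \<in> VF" "W \<in> VF" and f: "smooth f"
  shows "lie_bracket X (field_comb f Z W) =
    field_comb (X f) Z (field_comb f (lie_bracket X Z) (lie_bracket X W))"
proof (intro ext)
  fix h q
  show "lie_bracket X (field_comb f Z W) h q =
      X f q * Z h q + (f q * lie_bracket X Z h q + lie_bracket X W h q)"
  proof (cases "smooth h")
    case True
    have "smooth (Z h)" "smooth (W h)" using assms True smooth_VF by blast+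
    then have "X (\<lambda>q. f q * Z h q + W h q) q = f q * X (Z h) q + Z h q * X f q + X (W h) q"
      using VF_add[OF assms(1) smooth_mult[OF f \<open>smooth (Z h)\<close>] \<open>smooth (W h)\<close>, of q]
        VF_mult[OF assms(1) f \<open>smooth (Z h)\<close>, of q] by simp
    then show ?thesis by (simp add: lie_bracket_def algebra_simps)
  next
    case False
    then show ?thesis
      using assms VF_nonsmooth lie_bracket_in_VF vector_fields_module_op
      by (simp add: VF_nonsmooth[OF lie_bracket_in_VF])
  qed
qed

lemma lie_bracket_comb_left:
  assumes "X \<in> VF" "Z \<in> VF" "W \<in> VF" "smooth f"
  shows "lie_bracket (field_comb f Z W) X =
    field_comb (\<lambda>q. - X f q) Z (field_comb f (lie_bracket Z X) (lie_bracket W X))"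
proof (intro ext)
  fix h q
  have "lie_bracket (field_comb f Z W) X h q = - lie_bracket X (field_comb f Z W) h q"
    by (simp add: lie_bracket_def)
  then show "lie_bracket (field_comb f Z W) X h q =
      - X f q * Z h q + (f q * lie_bracket Z X h q + lie_bracket W X h q)"
    by (simp add: lie_bracket_comb_right[OF assms]) (simp add: lie_bracket_def algebra_simps)
qed

lemma VF_gfun_comb:
  assumes "X \<in> VF" "Y \<in> VF" "Z \<in> VF" "W \<in> VF" and f: "smooth f"
  shows "X (gfun g Y (field_comb f Z W)) p
      = X f p * gfun g Y Z p + f p * X (gfun g Y Z) p + X (gfun g Y W) p"
    and "X (gfun g (field_comb f Z W) Y) p
      = X f p * gfun g Z Y p + f p * X (gfun g Z Y) p + X (gfun g W Y) p"
proof -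
  have *: "X (\<lambda>p. f p * a p + c p) p = X f p * a p + f p * X a p + X c p"
    if "smooth a" "smooth c" for a c
    using VF_add[OF assms(1) smooth_mult[OF f that(1)] that(2)] VF_mult[OF assms(1) f that(1)] by simp
  have "gfun g Y (field_comb f Z W) = (\<lambda>p. f p * gfun g Y Z p + gfun g Y W p)"
    by (intro ext gfun_comb_right assms)
  then show "X (gfun g Y (field_comb f Z W)) p
      = X f p * gfun g Y Z p + f p * X (gfun g Y Z) p + X (gfun g Y W) p"
    by (simp add: * gfun_smooth assms)
  have "gfun g (field_comb f Z W) Y = (\<lambda>p. f p * gfun g Z Y p + gfun g W Y p)"
    by (intro ext gfun_comb_left assms)
  then show "X (gfun g (field_comb f Z W) Y) p
      = X f p * gfun g Z Y p + f p * X (gfun g Z Y) p + X (gfun g W Y) p"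
    by (simp add: * gfun_smooth assms)
qed

lemma koszul_smooth:
  assumes "X \<in> VF" "Y \<in> VF" "Z \<in> VF"
  shows "smooth (koszul g X Y Z)"
  unfolding koszul_def
  by (intro smooth_mult smooth_const smooth_add smooth_diff gfun_smooth lie_bracket_in_VF assms
      smooth_VF[OF assms(1) gfun_smooth] smooth_VF[OF assms(2) gfun_smooth]
      smooth_VF[OF assms(3) gfun_smooth])

text \<open>Derivatives of f arise from X g(Y,fZ) and Y g(fZ,X), and with opposite sign from
  g(Y,[fZ,X]) and -g(X,[Y,fZ]); they cancel in pairs.\<close>

lemma koszul_comb_third:
  assumes "X \<in> VF" "Y \<in> VF" "Z \<in> VF" "W \<in> VF" and f: "smooth f"
  shows "koszul g X Y (field_comb f Z W) p = f p * koszul g X Y Z p + koszul g X Y W p"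
proof -
  note [simp] = assms lie_bracket_in_VF vector_fields_module_op smooth_VF[OF assms(1) f]
    smooth_VF[OF assms(2) f]
  \<comment> \<open>Naming the coefficient \<open>- X f\<close> lets its smoothness be a simp rule
    for the linearity lemmas.\<close>
  define m where "m = (\<lambda>q. - X f q)"
  have [simp]: "smooth m"
    using smooth_diff[OF smooth_const smooth_VF[OF assms(1) f], of 0] by (simp add: m_def)
  have m: "lie_bracket (field_comb f Z W) X
      = field_comb m Z (field_comb f (lie_bracket Z X) (lie_bracket W X))"
    by (simp add: lie_bracket_comb_left m_def)
  have e1: "gfun g X (lie_bracket Y (field_comb f Z W)) p
      = Y f p * gfun g X Z p + (f p * gfun g X (lie_bracket Y Z) p + gfun g X (lie_bracket Y W) p)"
    by (simp add: lie_bracket_comb_right gfun_comb_right)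
  have e2: "gfun g Y (lie_bracket (field_comb f Z W) X) p
      = m p * gfun g Y Z p + (f p * gfun g Y (lie_bracket Z X) p + gfun g Y (lie_bracket W X) p)"
    by (simp add: m gfun_comb_right)
  have e3: "gfun g (field_comb f Z W) (lie_bracket X Y) p
      = f p * gfun g Z (lie_bracket X Y) p + gfun g W (lie_bracket X Y) p"
    by (simp add: gfun_comb_left)
  show ?thesis
    by (simp add: koszul_def e1 e2 e3 VF_gfun_comb gfun_sym[of X Z])
      (simp add: m_def field_simps)
qed

text \<open>Here the terms with Zf cancel, while Xf g(Y,Z) arises twice, from X g(fY,Z) and from
  g(Z,[X,fY]); the factor 1/2 leaves one copy.\<close>

lemma koszul_comb_second:
  assumes "X \<in> VF" "Y \<in> VF" "Z \<in> VF" "W \<in> VF" and f: "smooth f"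
  shows "koszul g X (field_comb f Y W) Z p
    = f p * koszul g X Y Z p + koszul g X W Z p + X f p * gfun g Y Z p"
proof -
  note [simp] = assms lie_bracket_in_VF vector_fields_module_op smooth_VF[OF assms(1) f]
    smooth_VF[OF assms(3) f]
  define m where "m = (\<lambda>q. - Z f q)"
  have [simp]: "smooth m"
    using smooth_diff[OF smooth_const smooth_VF[OF assms(3) f], of 0] by (simp add: m_def)
  have m: "lie_bracket (field_comb f Y W) Z
      = field_comb m Y (field_comb f (lie_bracket Y Z) (lie_bracket W Z))"
    by (simp add: lie_bracket_comb_left m_def)
  have e1: "gfun g X (lie_bracket (field_comb f Y W) Z) p
      = m p * gfun g X Y p + (f p * gfun g X (lie_bracket Y Z) p + gfun g X (lie_bracket W Z) p)"
    by (simp add: m gfun_comb_right)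
  have e2: "gfun g Z (lie_bracket X (field_comb f Y W)) p
      = X f p * gfun g Z Y p + (f p * gfun g Z (lie_bracket X Y) p + gfun g Z (lie_bracket X W) p)"
    by (simp add: lie_bracket_comb_right gfun_comb_right)
  have e3: "gfun g (field_comb f Y W) (lie_bracket Z X) p
      = f p * gfun g Y (lie_bracket Z X) p + gfun g W (lie_bracket Z X) p"
    by (simp add: gfun_comb_left)
  show ?thesis
    by (simp add: koszul_def e1 e2 e3 VF_gfun_comb gfun_sym[of Z Y])
      (simp add: m_def field_simps)
qed

end

subsection \<open>Conformally degenerate metrics\<close>

locale conformal_manifold = semi_riemannian_manifold A g
  for A :: "('a::{t2_space,second_countable_topology} set \<times> ('a \<Rightarrow> real^'n::finite)) set" and g +
  fixes \<Omega> :: "'a \<Rightarrow> real"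
  assumes smooth_\<Omega>: "smooth \<Omega>" and \<Omega>_nonneg: "0 \<le> \<Omega> p"
begin

definition h :: "'a bilin" where "h = (\<lambda>p v w. (\<Omega> p)\<^sup>2 * g p v w)"

lemma gfun_h: "gfun h X Y p = \<Omega> p * (\<Omega> p * gfun g X Y p)"
  by (simp add: gfun_def h_def power2_eq_square)

lemma metric_h: "sym_bilinear_metric A h"
proof -
  have "smooth (gfun h X Y)" if "X \<in> VF" "Y \<in> VF" for X Y
    unfolding gfun_h[abs_def] by (intro smooth_mult smooth_\<Omega> gfun_smooth that)
  then show ?thesis
    unfolding sym_bilinear_metric_def
    by (auto simp: h_def metric_sym metric_add_left metric_scale_left algebra_simps)
qed

sublocale h: metric_manifold A h
  by unfold_locales (rule metric_h)

text \<open>At a zero, \<Omega> has a minimum, so the frame derivations kill it there; the frame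
  expansion carries this over to every tangent vector.\<close>

lemma d\<Omega>_zero:
  assumes "v \<in> T p" "\<Omega> p = 0"
  shows "v \<Omega> = 0"
proof -
  obtain b \<xi> E where "cut_off_frame A b \<xi> E" and bp: "b p \<noteq> 0" by (rule local_frame)
  then interpret cut_off_frame A b \<xi> E by simp
  have "E i \<Omega> p = 0" for i
    using smooth_\<Omega> assms(2) \<Omega>_nonneg by (rule frame_minimum)
  with frame_expansion[OF assms(1) smooth_\<Omega>] bp show ?thesis by simp
qed

lemma VF_\<Omega>_zero: "X \<in> VF \<Longrightarrow> \<Omega> p = 0 \<Longrightarrow> X \<Omega> p = 0"
  using d\<Omega>_zero[OF at_pt_in_T] by (simp add: at_pt_def)

text \<open>The Koszul form of the conformal metric is divisible by the factor only once; \<kappa> is the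
  quotient.  It vanishes where \<Omega> does, since \<Omega> attains its minimum there.\<close>

definition \<kappa> where
  "\<kappa> X Y Z p = \<Omega> p * koszul g X Y Z p
    + (X \<Omega> p * gfun g Y Z p + Y \<Omega> p * gfun g Z X p - Z \<Omega> p * gfun g X Y p)"

text \<open>Each of the three derivative terms contributes 2 \<Omega> times a derivative of
  \<Omega>, and the 2 cancels the factor 1/2. Everything else, brackets included, carries
  \<Omega>^2.\<close>

lemma koszul_h:
  assumes "X \<in> VF" "Y \<in> VF" "Z \<in> VF"
  shows "koszul h X Y Z p = \<Omega> p * \<kappa> X Y Z p"
proof -
  have *: "W (gfun h U V) p = \<Omega> p * (\<Omega> p * W (gfun g U V) p) + 2 * \<Omega> p * W \<Omega> p * gfun g U V p"
    if W: "W \<in> VF" and UV: "U \<in> VF" "V \<in> VF" for W U V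
  proof -
    note G = gfun_smooth[OF UV]
    show ?thesis
      unfolding gfun_h[abs_def]
      using VF_mult[OF W smooth_\<Omega> smooth_mult[OF smooth_\<Omega> G], of p] VF_mult[OF W smooth_\<Omega> G, of p]
      by (simp add: algebra_simps)
  qed
  show ?thesis
    unfolding koszul_def[of h] \<kappa>_def koszul_def[of g]
    by (simp add: * assms gfun_h algebra_simps)
qed

lemma \<kappa>_smooth:
  assumes "X \<in> VF" "Y \<in> VF" "Z \<in> VF"
  shows "smooth (\<kappa> X Y Z)"
  unfolding \<kappa>_def[abs_def]
  by (intro smooth_add smooth_diff smooth_mult smooth_\<Omega> koszul_smooth gfun_smooth assms
      smooth_VF[OF assms(1) smooth_\<Omega>] smooth_VF[OF assms(2) smooth_\<Omega>] smooth_VF[OF assms(3) smooth_\<Omega>])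

lemma \<kappa>_one_form:
  assumes "X \<in> VF" "Y \<in> VF"
  shows "smooth_one_form A (\<kappa> X Y)"
  unfolding smooth_one_form_def
proof (intro conjI ballI allI impI ext \<kappa>_smooth assms)
  fix Z W f p assume "Z \<in> VF" "W \<in> VF" "smooth f"
  then show "\<kappa> X Y (field_comb f Z W) p = f p * \<kappa> X Y Z p + \<kappa> X Y W p"
    by (simp add: \<kappa>_def assms koszul_comb_third gfun_comb_left gfun_comb_right)
      (simp add: algebra_simps)
qed

text \<open>The surplus term, inherited from the Koszul form of g, is what later cancels the surplus
  of the product rule in the covariant derivative.\<close>

lemma \<kappa>_comb_second:
  assumes "X \<in> VF" "Y \<in> VF" "W \<in> VF" "Z \<in> VF" "smooth f"
  shows "\<kappa> X (field_comb f Y W) Z p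
    = f p * \<kappa> X Y Z p + \<kappa> X W Z p + \<Omega> p * (X f p * gfun g Y Z p)"
  using assms
  by (simp add: \<kappa>_def koszul_comb_second gfun_comb_left gfun_comb_right)
    (simp add: algebra_simps)

lemma \<kappa>_zero: "X \<in> VF \<Longrightarrow> Y \<in> VF \<Longrightarrow> Z \<in> VF \<Longrightarrow> \<Omega> p = 0 \<Longrightarrow> \<kappa> X Y Z p = 0"
  by (simp add: \<kappa>_def VF_\<Omega>_zero)

text \<open>Where \<Omega> is positive, R X Y is \<Omega> times the Levi-Civita derivative of Y
  along X for the conformal metric. Unlike that derivative it extends smoothly over the zeros of
  \<Omega>.\<close>

definition R where
  "R X Y = (SOME V. V \<in> VF \<and> (\<forall>Z\<in>VF. gfun g V Z = \<kappa> X Y Z))"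

lemma
  assumes "X \<in> VF" "Y \<in> VF"
  shows R_in_VF: "R X Y \<in> VF" and gfun_R: "Z \<in> VF \<Longrightarrow> gfun g (R X Y) Z = \<kappa> X Y Z"
proof -
  have "\<exists>V. V \<in> VF \<and> (\<forall>Z\<in>VF. gfun g V Z = \<kappa> X Y Z)"
    using metric_dual_exists[OF \<kappa>_one_form[OF assms]] by blast
  from someI_ex[OF this] show "R X Y \<in> VF" "Z \<in> VF \<Longrightarrow> gfun g (R X Y) Z = \<kappa> X Y Z"
    unfolding R_def by blast+
qed

text \<open>Where \<Omega>(p) = 0, the junk value 1 / 0 = 0 makes this the zero vector, which is the right
  representative there.\<close>

lemma flat_rep_nabla_flat:
  assumes "X \<in> VF" "Y \<in> VF"
  shows "flat_rep A h (nabla_flat h X Y) p (\<lambda>f. (1 / \<Omega> p) * at_pt (R X Y) p f)"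
  unfolding flat_rep_def
proof (intro conjI ballI)
  note R = at_pt_in_T[OF R_in_VF[OF assms], of p]
  show "(\<lambda>f. (1 / \<Omega> p) * at_pt (R X Y) p f) \<in> T p" by (rule tangent_space_scale[OF R])
  fix Z assume Z: "Z \<in> VF"
  have "nabla_flat h X Y Z p = \<Omega> p * gfun g (R X Y) Z p"
    using assms Z by (simp add: nabla_flat_def koszul_h gfun_R)
  also have "\<dots> = h p (\<lambda>f. (1 / \<Omega> p) * at_pt (R X Y) p f) (at_pt Z p)"
    using metric_scale_left[OF R at_pt_in_T[OF Z], of "1 / \<Omega> p"]
    by (simp add: h_def gfun_def power2_eq_square)
  finally show "nabla_flat h X Y Z p = h p (\<lambda>f. (1 / \<Omega> p) * at_pt (R X Y) p f) (at_pt Z p)" .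
qed

lemma nabla_flat_one_form:
  assumes "X \<in> VF" "Y \<in> VF"
  shows "smooth_one_form A (nabla_flat h X Y)"
  unfolding smooth_one_form_def nabla_flat_def
  using assms by (auto simp: h.koszul_smooth h.koszul_comb_third)

lemma radical_stationary_h: "radical_stationary A h"
  unfolding radical_stationary_def A_bullet_def
  using nabla_flat_one_form flat_rep_nabla_flat by blast

lemma inner_nabla_flat:
  assumes "X \<in> VF" "Y \<in> VF" "Z \<in> VF" "W \<in> VF"
  shows "inner_bullet A h p (nabla_flat h Z W) (nabla_flat h X Y) = \<kappa> Z W (R X Y) p"
proof -
  note R = R_in_VF[OF assms(1,2)] R_in_VF[OF assms(3,4)]
  note RT = R[THEN at_pt_in_T, of p]
  define c where "c = 1 / \<Omega> p"
  have "inner_bullet A h p (nabla_flat h Z W) (nabla_flat h X Y)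
      = h p (\<lambda>f. c * at_pt (R Z W) p f) (\<lambda>f. c * at_pt (R X Y) p f)"
    unfolding c_def by (intro h.inner_bullet_eq flat_rep_nabla_flat assms)
  also have "\<dots> = (\<Omega> p)\<^sup>2 * (c * (c * gfun g (R Z W) (R X Y) p))"
    unfolding h_def gfun_def
    using metric_scale_left[OF RT(2) tangent_space_scale[OF RT(1)], of c c]
      metric_sym[OF RT(2) tangent_space_scale[OF RT(1)], of c]
      metric_scale_left[OF RT, of c] metric_sym[OF RT] by simp
  \<comment> \<open>The scalar factor is 1 where \<Omega> is nonzero. At a zero it is 0 by the
    convention for division, and the equation survives because \<kappa> vanishes there too.\<close>
  also have "\<dots> = \<kappa> Z W (R X Y) p"
    using gfun_R[OF assms(3,4) R(1)] \<kappa>_zero[OF assms(3,4) R(1)]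
    by (cases "\<Omega> p = 0") (simp_all add: c_def power2_eq_square)
  finally show ?thesis .
qed

section \<open>The covariant derivative of the flat forms\<close>

lemma nabla_cov_eq:
  assumes "X \<in> VF" "Y \<in> VF" "Z \<in> VF" "W \<in> VF"
  shows "nabla_cov A h Z (nabla_flat h X Y) W p
    = Z (\<lambda>q. \<Omega> q * \<kappa> X Y W q) p - \<kappa> Z W (R X Y) p"
proof -
  have "nabla_flat h X Y W = (\<lambda>q. \<Omega> q * \<kappa> X Y W q)"
    using koszul_h assms by (simp add: nabla_flat_def fun_eq_iff)
  then show ?thesis by (simp add: nabla_cov_def inner_nabla_flat assms)
qed

text \<open>For linearity over f, the product rule leaves \<Omega> Zf \<kappa>(X,Y,U) in the first
  term. The second leaves \<Omega> Zf g(U,R(X,Y)), which is the same by duality and symmetry, and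
  the two are subtracted.\<close>

lemma nabla_cov_one_form:
  assumes XYZ: "X \<in> VF" "Y \<in> VF" "Z \<in> VF"
  shows "smooth_one_form A (nabla_cov A h Z (nabla_flat h X Y))"
  unfolding smooth_one_form_def
proof (intro conjI ballI allI impI)
  note R = R_in_VF[OF XYZ(1,2)]
  have prod: "smooth (\<lambda>q. \<Omega> q * \<kappa> X Y W q)" if "W \<in> VF" for W
    by (intro smooth_mult smooth_\<Omega> \<kappa>_smooth XYZ that)
  show "smooth (nabla_cov A h Z (nabla_flat h X Y) W)" if W: "W \<in> VF" for W
    unfolding nabla_cov_eq[OF XYZ W, abs_def]
    by (intro smooth_diff smooth_VF[OF XYZ(3) prod[OF W]] \<kappa>_smooth XYZ W R)
  fix U W f assume UW: "U \<in> VF" "W \<in> VF" and f: "smooth f"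
  have comb: "field_comb f U W \<in> VF" by (rule vector_fields_module_op[OF f UW])
  have *: "(\<lambda>q. \<Omega> q * \<kappa> X Y (field_comb f U W) q)
      = (\<lambda>q. f q * (\<Omega> q * \<kappa> X Y U q) + \<Omega> q * \<kappa> X Y W q)"
    unfolding one_form_comb[OF \<kappa>_one_form[OF XYZ(1,2)] UW f] by (simp add: algebra_simps)
  have "nabla_cov A h Z (nabla_flat h X Y) (field_comb f U W) p
      = f p * nabla_cov A h Z (nabla_flat h X Y) U p + nabla_cov A h Z (nabla_flat h X Y) W p" for p
  proof -
    have "Z (\<lambda>q. \<Omega> q * \<kappa> X Y (field_comb f U W) q) p
        = f p * Z (\<lambda>q. \<Omega> q * \<kappa> X Y U q) p + \<Omega> p * \<kappa> X Y U p * Z f p + Z (\<lambda>q. \<Omega> q * \<kappa> X Y W q) p"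
      unfolding *
      using VF_add[OF XYZ(3) smooth_mult[OF f prod[OF UW(1)]] prod[OF UW(2)], of p]
        VF_mult[OF XYZ(3) f prod[OF UW(1)], of p] by simp
    moreover have "\<kappa> Z (field_comb f U W) (R X Y) p
        = f p * \<kappa> Z U (R X Y) p + \<kappa> Z W (R X Y) p + \<Omega> p * (Z f p * \<kappa> X Y U p)"
      using \<kappa>_comb_second[OF XYZ(3) UW R f, of p] gfun_sym[OF UW(1) R, of p]
        gfun_R[OF XYZ(1,2) UW(1)] by simp
    ultimately show ?thesis
      unfolding nabla_cov_eq[OF XYZ comb] nabla_cov_eq[OF XYZ UW(1)] nabla_cov_eq[OF XYZ UW(2)]
      by (simp add: algebra_simps)
  qed
  then show "nabla_cov A h Z (nabla_flat h X Y) (field_comb f U W)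
      = (\<lambda>p. f p * nabla_cov A h Z (nabla_flat h X Y) U p + nabla_cov A h Z (nabla_flat h X Y) W p)"
    by (simp add: fun_eq_iff)
qed

lemma semi_regular_h: "semi_regular A h"
  unfolding semi_regular_def A_bullet_def
proof (intro conjI ballI allI radical_stationary_h nabla_cov_one_form)
  fix X Y Z p assume XYZ: "X \<in> VF" "Y \<in> VF" "Z \<in> VF"
  let ?\<omega> = "nabla_cov A h Z (nabla_flat h X Y)"
  note R = R_in_VF[OF XYZ(1,2)]
  obtain V where V: "V \<in> VF" "\<And>W. W \<in> VF \<Longrightarrow> gfun g V W = ?\<omega> W"
    using metric_dual_exists[OF nabla_cov_one_form[OF XYZ]] by blast
  note VT = at_pt_in_T[OF V(1), of p]
  \<comment> \<open>The metric dual V with respect to g is rescaled to the metric \<Omega>^2 g. At a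
    zero of \<Omega> this is the zero vector, and any tangent vector would do there since both sides
    vanish. Only pointwise existence is asked, so u may blow up near the zeros.\<close>
  define u where "u = (\<lambda>f. (1 / (\<Omega> p)\<^sup>2) * at_pt V p f)"
  have "?\<omega> W p = h p u (at_pt W p)" if W: "W \<in> VF" for W
  proof (cases "\<Omega> p = 0")
    case True
    \<comment> \<open>One term of the product rule contains \<Omega> itself, the other the
      derivative of \<Omega>; both are zero at p.\<close>
    have "Z (\<lambda>q. \<Omega> q * \<kappa> X Y W q) p = 0"
      using VF_mult[OF XYZ(3) smooth_\<Omega> \<kappa>_smooth[OF XYZ(1,2) W], of p] VF_\<Omega>_zero[OF XYZ(3) True] True
      by simp
    then have "?\<omega> W p = 0"
      using \<kappa>_zero[OF XYZ(3) W R True] by (simp add: nabla_cov_eq XYZ W)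
    then show ?thesis using True by (simp add: h_def)
  next
    case False
    have "h p u (at_pt W p) = gfun g V W p"
      using metric_scale_left[OF VT at_pt_in_T[OF W], of "1 / (\<Omega> p)\<^sup>2"] False
      by (simp add: h_def u_def gfun_def)
    then show ?thesis by (simp add: V W)
  qed
  moreover have "u \<in> T p" unfolding u_def by (rule tangent_space_scale[OF VT])
  ultimately show "\<exists>u. flat_rep A h ?\<omega> p u"
    unfolding flat_rep_def by blast
qed

end

theorem theorem9p3:
  fixes A :: "('a::{t2_space,second_countable_topology} set \<times> ('a \<Rightarrow> real^'n::finite)) set"
    and gt :: "'a bilin"
    and \<Omega> :: "'a \<Rightarrow> real"
  assumes "smooth_atlas A"
    and "semi_riemannian_metric A gt"
    and "smooth_fun A \<Omega>"
    and "\<forall>p. \<Omega> p \<ge> 0"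
  shows "sym_bilinear_metric A (\<lambda>p v w. (\<Omega> p)^2 * gt p v w)
       \<and> semi_regular A (\<lambda>p v w. (\<Omega> p)^2 * gt p v w)"
proof -
  interpret conformal_manifold A gt \<Omega>
    by unfold_locales (use assms in \<open>auto simp: semi_riemannian_metric_def\<close>)
  show ?thesis
    using metric_h semi_regular_h unfolding h_def by blast
qed

end
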